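(* Let $\mathcal{I}$ be an $\mathcal{R}$-monoid, let $\mathcal{S} \subseteq \mathcal{P}(\mathbb{N})$ be closed under subsets, and let $\mathcal{L}$ be a class of languages. The following are equivalent: (1) there is a learner $h\in\mathcal I$ that $\mathbf{Txt}\mathbf{G}\mathbf{Wb}\mathbf{Ex}$-learns every $L\in\mathcal L$ and that, on every text $T\in\mathbf{Txt}(\mathcal S)$, is defined (i.e. $\mathbf G(h,T)$ is total) and satisfies $\mathbf{Wb}(\mathbf G(h,T),T)$; (2) there is a learner $h\in\mathcal I$ that $\mathbf{Txt}\mathbf{G}\mathbf{Caut}_{\mathbf{Tar}}\mathbf{Ex}$-learns every $L\in\mathcal L$ and that is defined on every text $T\in\mathbf{Txt}(\mathcal S)$.
   Context: Fix an acceptable numbering $(\varphi_e)$ of partial computable functions, $W_e=\mathrm{dom}(\varphi_e)$. A text is a total function $T:\mathbb N\to\mathbb N\cup\{\#\}$, $\mathrm{content}(T)=\mathrm{range}(T)\setminus\{\#\}$, $T[n]=(T(0),\dots,T(n-1))$; $\mathbf{Txt}(L)$ is the set of texts with content $L$, and for $\mathcal S$ closed under subsets $\mathbf{Txt}(\mathcal S)=\bigcup_{S\in\mathcal S}\mathbf{Txt}(S)$. Learners are partial computable functions; $\mathbf G(h,T)(i)=h(T[i])$. For total $p:\mathbb N\to\mathbb N$ and a text $T$: $\mathbf{Ex}(p,T)$ iff $\exists n_0\,\forall n\ge n_0: p(n)=p(n_0)\wedge W_{p(n_0)}=\mathrm{content}(T)$; $\mathbf{Wb}(p,T)$ iff for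 all $n,m$: if there is $k$ with $n\le k\le m$ and $p(n)\ne p(k)$, then $(\mathrm{content}(T[m])\cap W_{p(m)})\setminus W_{p(n)}\ne\emptyset$; $\mathbf{Caut}_{\mathbf{Tar}}(p,T)$ iff for no $n$ is $\mathrm{content}(T)\subsetneq W_{p(n)}$. $h$ $\mathbf{Txt}\beta\delta\mathbf{Ex}$-learns $L$ iff for every $T\in\mathbf{Txt}(L)$, $\beta(h,T)$ is total and $\delta(\beta(h,T),T)$ and $\mathbf{Ex}(\beta(h,T),T)$ hold. $\mathcal R$ is the set of total computable functions; $\mathcal I\subseteq$ (partial computable functions) is an $\mathcal R$-monoid iff $(\mathcal I,\circ)$ is a monoid and $\mathcal R\subseteq\mathcal I$. *)

theory Defs
  imports Main "HOL-Library.Nat_Bijection"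
begin

text \<open>A partial function of arity n is modelled as nat list => nat option
  (only arguments of length n matter).  None means "undefined".\<close>

fun prec :: "(nat list \<Rightarrow> nat option) \<Rightarrow> (nat list \<Rightarrow> nat option) \<Rightarrow> nat \<Rightarrow> nat list \<Rightarrow> nat option" where
  "prec g h 0 xs = g xs"
| "prec g h (Suc k) xs = Option.bind (prec g h k xs) (\<lambda>r. h (k # r # xs))"

definition mu :: "(nat list \<Rightarrow> nat option) \<Rightarrow> nat list \<Rightarrow> nat option" where
  "mu f xs = (if \<exists>y. f (y # xs) = Some 0 \<and> (\<forall>z<y. f (z # xs) \<noteq> None)
              then Some (LEAST y. f (y # xs) = Some 0 \<and> (\<forall>z<y. f (z # xs) \<noteq> None))
              else None)"

inductive partrec :: "nat \<Rightarrow> (nat list \<Rightarrow> nat option) \<Rightarrow> bool" where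
  zero: "partrec n (\<lambda>xs. Some 0)"
| succ: "partrec 1 (\<lambda>xs. Some (Suc (hd xs)))"
| proj: "i < n \<Longrightarrow> partrec n (\<lambda>xs. Some (xs ! i))"
| comp: "partrec m f \<Longrightarrow> length gs = m \<Longrightarrow> (\<forall>g\<in>set gs. partrec n g) \<Longrightarrow>
         partrec n (\<lambda>xs. if (\<forall>g\<in>set gs. g xs \<noteq> None)
                          then f (map (\<lambda>g. the (g xs)) gs) else None)"
| prim_rec: "partrec n g \<Longrightarrow> partrec (Suc (Suc n)) h \<Longrightarrow>
            partrec (Suc n) (\<lambda>xs. prec g h (hd xs) (tl xs))"
| minimize: "partrec (Suc n) f \<Longrightarrow> partrec n (mu f)"

definition pcomputable :: "(nat \<Rightarrow> nat option) \<Rightarrow> bool" where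
  "pcomputable \<phi> \<longleftrightarrow> (\<exists>f. partrec 1 f \<and> (\<forall>x. \<phi> x = f [x]))"

definition Rfun :: "(nat \<Rightarrow> nat option) set" where
  "Rfun = {\<phi>. pcomputable \<phi> \<and> (\<forall>x. \<phi> x \<noteq> None)}"

definition pcomp :: "(nat \<Rightarrow> nat option) \<Rightarrow> (nat \<Rightarrow> nat option) \<Rightarrow> nat \<Rightarrow> nat option" where
  "pcomp f g = (\<lambda>x. Option.bind (g x) f)"

definition pid :: "nat \<Rightarrow> nat option" where
  "pid = (\<lambda>x. Some x)"

definition R_monoid :: "(nat \<Rightarrow> nat option) set \<Rightarrow> bool" where
  "R_monoid I \<longleftrightarrow> (\<forall>f\<in>I. pcomputable f) \<and> pid \<in> I
     \<and> (\<forall>f\<in>I. \<forall>g\<in>I. pcomp f g \<in> I) \<and> Rfun \<subseteq> I"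

definition computable_numbering :: "(nat \<Rightarrow> nat \<Rightarrow> nat option) \<Rightarrow> bool" where
  "computable_numbering \<psi> \<longleftrightarrow>
     pcomputable (\<lambda>p. \<psi> (fst (prod_decode p)) (snd (prod_decode p)))"

definition acceptable :: "(nat \<Rightarrow> nat \<Rightarrow> nat option) \<Rightarrow> bool" where
  "acceptable \<phi> \<longleftrightarrow> computable_numbering \<phi> \<and>
     (\<forall>\<psi>. computable_numbering \<psi> \<longrightarrow>
        (\<exists>t\<in>Rfun. \<forall>e. \<psi> e = \<phi> (the (t e))))"

definition W :: "(nat \<Rightarrow> nat \<Rightarrow> nat option) \<Rightarrow> nat \<Rightarrow> nat set" where
  "W \<phi> e = {x. \<phi> e x \<noteq> None}"

text \<open>A text is a total function nat => nat option; None plays the role of the pause symbol #.\<close>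
type_synonym ltext = "nat \<Rightarrow> nat option"

definition content :: "ltext \<Rightarrow> nat set" where
  "content T = {x. \<exists>n. T n = Some x}"

definition initseg :: "ltext \<Rightarrow> nat \<Rightarrow> nat option list" where
  "initseg T n = map T [0..<n]"

definition content_seq :: "nat option list \<Rightarrow> nat set" where
  "content_seq \<sigma> = {x. Some x \<in> set \<sigma>}"

definition seq_code :: "nat option list \<Rightarrow> nat" where
  "seq_code \<sigma> = list_encode (map (\<lambda>c. case c of None \<Rightarrow> 0 | Some x \<Rightarrow> Suc x) \<sigma>)"

definition Gseq :: "(nat \<Rightarrow> nat option) \<Rightarrow> ltext \<Rightarrow> nat \<Rightarrow> nat option" where
  "Gseq h T i = h (seq_code (initseg T i))"

definition Gtotal :: "(nat \<Rightarrow> nat option) \<Rightarrow> ltext \<Rightarrow> bool" where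
  "Gtotal h T \<longleftrightarrow> (\<forall>i. Gseq h T i \<noteq> None)"

text \<open>The learning sequence as a total function (meaningful when Gtotal h T).\<close>
definition G :: "(nat \<Rightarrow> nat option) \<Rightarrow> ltext \<Rightarrow> nat \<Rightarrow> nat" where
  "G h T i = the (Gseq h T i)"

definition Ex :: "(nat \<Rightarrow> nat \<Rightarrow> nat option) \<Rightarrow> (nat \<Rightarrow> nat) \<Rightarrow> ltext \<Rightarrow> bool" where
  "Ex \<phi> p T \<longleftrightarrow> (\<exists>n0. (\<forall>n\<ge>n0. p n = p n0) \<and> W \<phi> (p n0) = content T)"

definition Wb :: "(nat \<Rightarrow> nat \<Rightarrow> nat option) \<Rightarrow> (nat \<Rightarrow> nat) \<Rightarrow> ltext \<Rightarrow> bool" where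
  "Wb \<phi> p T \<longleftrightarrow> (\<forall>n m. (\<exists>k. n \<le> k \<and> k \<le> m \<and> p n \<noteq> p k) \<longrightarrow>
       (content_seq (initseg T m) \<inter> W \<phi> (p m)) - W \<phi> (p n) \<noteq> {})"

definition CautTar :: "(nat \<Rightarrow> nat \<Rightarrow> nat option) \<Rightarrow> (nat \<Rightarrow> nat) \<Rightarrow> ltext \<Rightarrow> bool" where
  "CautTar \<phi> p T \<longleftrightarrow> (\<forall>n. \<not> (content T \<subset> W \<phi> (p n)))"

definition TxtGEx_learns ::
  "(nat \<Rightarrow> nat \<Rightarrow> nat option) \<Rightarrow> ((nat \<Rightarrow> nat \<Rightarrow> nat option) \<Rightarrow> (nat \<Rightarrow> nat) \<Rightarrow> ltext \<Rightarrow> bool)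
   \<Rightarrow> (nat \<Rightarrow> nat option) \<Rightarrow> nat set \<Rightarrow> bool" where
  "TxtGEx_learns \<phi> \<delta> h L \<longleftrightarrow>
     (\<forall>T. content T = L \<longrightarrow> Gtotal h T \<and> \<delta> \<phi> (G h T) T \<and> Ex \<phi> (G h T) T)"

definition closed_under_subsets :: "nat set set \<Rightarrow> bool" where
  "closed_under_subsets S \<longleftrightarrow> (\<forall>A\<in>S. \<forall>B. B \<subseteq> A \<longrightarrow> B \<in> S)"

end

theory Submission
  imports Defs
begin

text \<open>
  The converse direction turns a target-cautious learner \<open>h\<close> into a total computable one. For a finite
  sequence \<open>s\<close> let the hypothesis of \<open>s\<close> enumerate the content of \<open>s\<close> and then, if \<open>W (h s)\<close> turns
  out to contain it, stage by stage also \<open>W (h s)\<close>, but only as long as no sequence \<open>\<rho>\<close> over the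
  elements enumerated so far is seen to satisfy \<open>h (s @ \<rho>) \<noteq> h s\<close>.
  The new learner keeps a sequence \<open>s\<close> as its state and, having read \<open>\<sigma>\<close>, replaces it by
  \<open>s @ \<rho> @ \<sigma>\<close> once it sees such a \<open>\<rho>\<close> over \<open>\<sigma>\<close> while the hypothesis has not yet
  enumerated all of \<open>\<sigma>\<close>. From then on the hypothesis of \<open>s\<close> can never enumerate all of \<open>\<sigma>\<close>, whereas
  all later hypotheses do; this is the witness demanded by \<open>Wb\<close>.

  On a text for a learned language \<open>L\<close> the states stabilise, because their union would otherwise be a text
  for \<open>L\<close> on which \<open>h\<close> changes its mind infinitely often. If the hypothesis of the last state \<open>s\<close>
  covers \<open>L\<close>, it equals \<open>L\<close> because \<open>W (h s)\<close> is not a proper superset of \<open>L\<close>. If not, no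
  mind change over \<open>L\<close> exists above \<open>s\<close>, so \<open>s\<close> is a locking sequence with \<open>W (h s) = L\<close>
  and its hypothesis is never stopped.
\<close>

section \<open>Recursive functions on encoded data\<close>

definition total_rec :: "nat \<Rightarrow> (nat list \<Rightarrow> nat) \<Rightarrow> bool" where
  "total_rec n f \<longleftrightarrow> (\<exists>g. partrec n g \<and> (\<forall>xs. length xs = n \<longrightarrow> g xs = Some (f xs)))"

named_theorems rec_intros

lemma total_rec_cong:
  assumes "total_rec n f" "\<And>xs. length xs = n \<Longrightarrow> f xs = f' xs"
  shows "total_rec n f'"
  using assms unfolding total_rec_def by metis

lemma total_rec_proj [rec_intros]: "i < n \<Longrightarrow> total_rec n (\<lambda>xs. xs ! i)"
  unfolding total_rec_def using partrec.proj by blast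

text \<open>Realisers are chosen as a function \<open>P\<close> of the component, so
  \<open>map P gs\<close> is a list to which \<open>partrec.comp\<close> applies.\<close>

lemma total_rec_compose:
  assumes "total_rec (length gs) f" "\<forall>g\<in>set gs. total_rec n g"
  shows "total_rec n (\<lambda>xs. f (map (\<lambda>g. g xs) gs))"
proof -
  obtain F where F: "partrec (length gs) F" "\<And>xs. length xs = length gs \<Longrightarrow> F xs = Some (f xs)"
    using assms(1) unfolding total_rec_def by blast
  obtain P where P: "\<forall>g\<in>set gs. partrec n (P g) \<and> (\<forall>xs. length xs = n \<longrightarrow> P g xs = Some (g xs))"
    using assms(2) unfolding total_rec_def by metis
  have "partrec n (\<lambda>xs. if \<forall>g\<in>set (map P gs). g xs \<noteq> None
                        then F (map (\<lambda>g. the (g xs)) (map P gs)) else None)"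
    by (rule partrec.comp[OF F(1)]) (use P in auto)
  moreover have "(if \<forall>g\<in>set (map P gs). g xs \<noteq> None
                  then F (map (\<lambda>g. the (g xs)) (map P gs)) else None)
               = Some (f (map (\<lambda>g. g xs) gs))" if "length xs = n" for xs
  proof -
    have "map (\<lambda>g. the (g xs)) (map P gs) = map (\<lambda>g. g xs) gs"
      using P that by simp
    then show ?thesis using P that F(2)[of "map (\<lambda>g. g xs) gs"] by (simp del: map_map)
  qed
  ultimately show ?thesis unfolding total_rec_def by blast
qed

lemma total_rec_app1:
  assumes "total_rec 1 (\<lambda>xs. f (xs ! 0))" "total_rec n g"
  shows "total_rec n (\<lambda>xs. f (g xs))"
  using total_rec_compose[of "[g]" "\<lambda>xs. f (xs ! 0)"] assms by simp

lemma total_rec_app2: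
  assumes "total_rec 2 (\<lambda>xs. f (xs ! 0) (xs ! 1))" "total_rec n g" "total_rec n h"
  shows "total_rec n (\<lambda>xs. f (g xs) (h xs))"
  using total_rec_compose[of "[g, h]" "\<lambda>xs. f (xs ! 0) (xs ! 1)"] assms by (simp add: numeral_2_eq_2)

lemma total_rec_app3:
  assumes "total_rec 3 (\<lambda>xs. f (xs ! 0) (xs ! 1) (xs ! 2))"
    "total_rec n g" "total_rec n h" "total_rec n k"
  shows "total_rec n (\<lambda>xs. f (g xs) (h xs) (k xs))"
  using total_rec_compose[of "[g, h, k]" "\<lambda>xs. f (xs ! 0) (xs ! 1) (xs ! 2)"] assms
  by (simp add: numeral_3_eq_3 numeral_2_eq_2)

lemma total_rec_Suc [rec_intros]:
  assumes "total_rec n g" shows "total_rec n (\<lambda>xs. Suc (g xs))"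
proof (rule total_rec_app1[OF _ assms])
  show "total_rec 1 (\<lambda>xs. Suc (xs ! 0))"
    unfolding total_rec_def
    by (rule exI, rule conjI[OF partrec.succ]) (auto simp: length_Suc_conv)
qed

lemma total_rec_const [rec_intros]: "total_rec n (\<lambda>xs. c)"
proof (induction c)
  case 0
  then show ?case unfolding total_rec_def using partrec.zero by blast
qed (rule total_rec_Suc)

text \<open>In a primitive recursion the step function sees the counter, the previous value and then
  the parameters; \<open>drop 2\<close> recovers the parameters.\<close>

lemma total_rec_drop2 [rec_intros]:
  assumes "i + 2 < n" shows "total_rec n (\<lambda>xs. drop 2 xs ! i)"
  by (rule total_rec_cong[OF total_rec_proj[of "i + 2"]]) (use assms in \<open>auto simp: add.commute\<close>)

lemma total_rec_rec_nat [rec_intros]: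
  assumes a: "total_rec n a" and k: "total_rec n k"
    and s: "total_rec (Suc (Suc n)) (\<lambda>ys. s (ys ! 0) (ys ! 1) (drop 2 ys))"
  shows "total_rec n (\<lambda>xs. rec_nat (a xs) (\<lambda>i r. s i r xs) (k xs))"
proof -
  obtain A where A: "partrec n A" "\<And>xs. length xs = n \<Longrightarrow> A xs = Some (a xs)"
    using a unfolding total_rec_def by blast
  obtain H where H: "partrec (Suc (Suc n)) H"
    "\<And>xs. length xs = Suc (Suc n) \<Longrightarrow> H xs = Some (s (xs ! 0) (xs ! 1) (drop 2 xs))"
    using s unfolding total_rec_def by blast
  have prec_eq: "prec A H j xs = Some (rec_nat (a xs) (\<lambda>i r. s i r xs) j)" if "length xs = n" for j xs
    using that by (induction j) (simp_all add: A(2) H(2))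
  have "total_rec (Suc n) (\<lambda>xs. rec_nat (a (tl xs)) (\<lambda>i r. s i r (tl xs)) (hd xs))"
    unfolding total_rec_def
    by (rule exI, rule conjI[OF partrec.prim_rec[OF A(1) H(1)]]) (auto simp: prec_eq)
  \<comment> \<open>\<open>prec\<close> recurses on the first argument; composing with
    \<open>k\<close> followed by all projections feeds it \<open>k xs\<close> and leaves the
    parameters intact.\<close>
  then have "total_rec (length (k # map (\<lambda>i xs. xs ! i) [0..<n]))
      (\<lambda>xs. rec_nat (a (tl xs)) (\<lambda>i r. s i r (tl xs)) (hd xs))"
    by simp
  from total_rec_compose[OF this, of n] have
    "total_rec n (\<lambda>xs. rec_nat (a (map (\<lambda>i. xs ! i) [0..<n]))
       (\<lambda>i r. s i r (map (\<lambda>i. xs ! i) [0..<n])) (k xs))"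
    using k total_rec_proj by (auto simp: comp_def)
  then show ?thesis
    by (rule total_rec_cong) (metis map_nth)
qed

lemma total_rec_add [rec_intros]:
  assumes "total_rec n f" "total_rec n g" shows "total_rec n (\<lambda>xs. f xs + g xs)"
proof (rule total_rec_app2[OF _ assms])
  have eq: "x + y = rec_nat x (\<lambda>_. Suc) y" for x y :: nat
    by (induction y) simp_all
  show "total_rec 2 (\<lambda>xs. xs ! 0 + xs ! 1)"
    unfolding eq by (intro rec_intros; simp)
qed

lemma total_rec_diff [rec_intros]:
  assumes "total_rec n f" "total_rec n g" shows "total_rec n (\<lambda>xs. f xs - g xs)"
proof (rule total_rec_app2[OF _ assms])
  have pred_eq: "x - 1 = rec_nat 0 (\<lambda>i _. i) x" for x :: nat
    by (cases x) simp_all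
  have pred: "total_rec m (\<lambda>xs. h xs - 1)" if "total_rec m h" for m h
  proof (rule total_rec_app1[OF _ that])
    show "total_rec 1 (\<lambda>xs. xs ! 0 - 1)"
      unfolding pred_eq by (intro rec_intros; simp)
  qed
  have eq: "x - y = rec_nat x (\<lambda>_ r. r - 1) y" for x y :: nat
    by (induction y) simp_all
  have "total_rec 2 (\<lambda>xs. rec_nat (xs ! 0) (\<lambda>_ r. r - 1) (xs ! 1))"
    by (intro rec_intros pred; simp)
  then show "total_rec 2 (\<lambda>xs. xs ! 0 - xs ! 1)"
    by (simp only: eq[symmetric])
qed

lemma total_rec_if_zero [rec_intros]:
  assumes "total_rec n f" "total_rec n g" "total_rec n h"
  shows "total_rec n (\<lambda>xs. if f xs = 0 then g xs else h xs)"
proof (rule total_rec_app3[OF _ assms])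
  have eq: "(if x = 0 then y else z) = rec_nat y (\<lambda>_ _. z) x" for x y z :: nat
    by (cases x) simp_all
  show "total_rec 3 (\<lambda>xs. if xs ! 0 = 0 then xs ! 1 else xs ! 2)"
    unfolding eq by (intro rec_intros; simp)
qed

lemma total_rec_if_eq [rec_intros]:
  assumes "total_rec n p" "total_rec n q" "total_rec n g" "total_rec n h"
  shows "total_rec n (\<lambda>xs. if p xs = q xs then g xs else h xs)"
proof -
  have "total_rec n (\<lambda>xs. if p xs - q xs + (q xs - p xs) = 0 then g xs else h xs)"
    by (intro rec_intros assms)
  moreover have "(x - y + (y - x) = 0) = (x = y)" for x y :: nat by auto
  ultimately show ?thesis by simp
qed

section \<open>Inverting the Cantor pairing function\<close>

lemma total_rec_triangle [rec_intros]:
  assumes "total_rec n f" shows "total_rec n (\<lambda>xs. triangle (f xs))"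
proof -
  have eq: "triangle x = rec_nat 0 (\<lambda>i r. r + Suc i) x" for x
    by (induction x) simp_all
  show ?thesis
    by (rule total_rec_app1[OF _ assms], unfold eq) (intro rec_intros; simp)
qed

text \<open>The sum of the two components of the pair coded by \<open>n\<close>, by recursion on \<open>n\<close>.\<close>
primrec diagonal :: "nat \<Rightarrow> nat" where
  "diagonal 0 = 0"
| "diagonal (Suc n) =
    (if Suc n = triangle (Suc (diagonal n)) then Suc (diagonal n) else diagonal n)"

lemma diagonal_bounds: "triangle (diagonal n) \<le> n \<and> n < triangle (Suc (diagonal n))"
  by (induction n) auto

text \<open>\<open>prod_encode (m, n)\<close> is \<open>triangle (m + n) + m\<close>, so once the
  sum \<open>m + n\<close> is known both components are differences.\<close>

lemma prod_decode_diagonal: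
  "prod_decode n = (n - triangle (diagonal n), diagonal n - (n - triangle (diagonal n)))"
proof -
  have "prod_encode (n - triangle (diagonal n), diagonal n - (n - triangle (diagonal n))) = n"
    using diagonal_bounds[of n] by (simp add: prod_encode_def)
  then show ?thesis by (metis prod_encode_inverse)
qed

lemma total_rec_diagonal [rec_intros]:
  assumes "total_rec n f" shows "total_rec n (\<lambda>xs. diagonal (f xs))"
  by (rule total_rec_app1[OF _ assms], unfold diagonal_def) (intro rec_intros; simp)

lemma total_rec_prod_encode [rec_intros]:
  assumes "total_rec n f" "total_rec n g"
  shows "total_rec n (\<lambda>xs. prod_encode (f xs, g xs))"
  unfolding prod_encode_def split_conv by (intro rec_intros assms)

lemma total_rec_fst_prod_decode [rec_intros]:
  assumes "total_rec n f" shows "total_rec n (\<lambda>xs. fst (prod_decode (f xs)))"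
  unfolding prod_decode_diagonal fst_conv by (intro rec_intros assms)

lemma total_rec_snd_prod_decode [rec_intros]:
  assumes "total_rec n f" shows "total_rec n (\<lambda>xs. snd (prod_decode (f xs)))"
  unfolding prod_decode_diagonal snd_conv by (intro rec_intros assms)

section \<open>Unary recursive functions\<close>

definition unary_rec :: "(nat \<Rightarrow> nat) \<Rightarrow> bool" where
  "unary_rec f \<longleftrightarrow> total_rec 1 (\<lambda>xs. f (xs ! 0))"

lemma unary_rec_comp: "unary_rec f \<Longrightarrow> unary_rec g \<Longrightarrow> unary_rec (\<lambda>x. f (g x))"
  unfolding unary_rec_def by (rule total_rec_app1)

lemma unary_rec_total_rec: "unary_rec f \<Longrightarrow> total_rec n g \<Longrightarrow> total_rec n (\<lambda>xs. f (g xs))"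
  unfolding unary_rec_def by (rule total_rec_app1)

lemma unary_rec_id: "unary_rec (\<lambda>x. x)"
  and unary_rec_const: "unary_rec (\<lambda>x. c)"
  and unary_rec_Suc: "unary_rec f \<Longrightarrow> unary_rec (\<lambda>x. Suc (f x))"
  and unary_rec_diff: "unary_rec f \<Longrightarrow> unary_rec g \<Longrightarrow> unary_rec (\<lambda>x. f x - g x)"
  and unary_rec_prod_encode: "unary_rec f \<Longrightarrow> unary_rec g \<Longrightarrow> unary_rec (\<lambda>x. prod_encode (f x, g x))"
  and unary_rec_fst: "unary_rec f \<Longrightarrow> unary_rec (\<lambda>x. fst (prod_decode (f x)))"
  and unary_rec_snd: "unary_rec f \<Longrightarrow> unary_rec (\<lambda>x. snd (prod_decode (f x)))"
  and unary_rec_if_zero: "unary_rec f \<Longrightarrow> unary_rec g \<Longrightarrow> unary_rec h \<Longrightarrow>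
        unary_rec (\<lambda>x. if f x = 0 then g x else h x)"
  and unary_rec_if_eq: "unary_rec p \<Longrightarrow> unary_rec q \<Longrightarrow> unary_rec f \<Longrightarrow> unary_rec g \<Longrightarrow>
        unary_rec (\<lambda>x. if p x = q x then f x else g x)"
  unfolding unary_rec_def by (intro rec_intros; simp)+

lemmas unary_rec_intros = unary_rec_id unary_rec_const unary_rec_Suc unary_rec_diff
  unary_rec_prod_encode unary_rec_fst unary_rec_snd unary_rec_if_zero unary_rec_if_eq

text \<open>Parameter, counter and previous value are packed into one number, in the shape in which
  \<open>enc\<close> later codes the triple \<open>(x, i, r)\<close>.\<close>

lemma unary_rec_rec_nat:
  assumes "unary_rec a" "unary_rec k" "unary_rec s"
  shows "unary_rec (\<lambda>x. rec_nat (a x) (\<lambda>i r. s (prod_encode (x, prod_encode (i, r)))) (k x))"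
  using assms(1,2) unfolding unary_rec_def
  by (intro rec_intros unary_rec_total_rec[OF assms(3)]; simp)

section \<open>Data types coded by natural numbers\<close>

class encodable =
  fixes enc :: "'a \<Rightarrow> nat"
  assumes enc_eq_iff [simp]: "enc x = enc y \<longleftrightarrow> x = y"

instantiation nat :: encodable begin
definition enc_nat :: "nat \<Rightarrow> nat" where [simp]: "enc_nat n = n"
instance by standard simp
end

instantiation bool :: encodable begin
definition enc_bool :: "bool \<Rightarrow> nat" where [simp]: "enc_bool b = (if b then 1 else 0)"
instance by standard simp
end

instantiation option :: (encodable) encodable begin
definition enc_option :: "'a option \<Rightarrow> nat" where
  "enc_option u = (case u of None \<Rightarrow> 0 | Some x \<Rightarrow> Suc (enc x))"
instance by standard (simp add: enc_option_def split: option.split)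
end

instantiation prod :: (encodable, encodable) encodable begin
definition enc_prod :: "'a \<times> 'b \<Rightarrow> nat" where
  "enc_prod p = prod_encode (enc (fst p), enc (snd p))"
instance by standard (simp add: enc_prod_def prod_encode_eq prod_eq_iff)
end

instantiation list :: (encodable) encodable begin
definition enc_list :: "'a list \<Rightarrow> nat" where
  "enc_list xs = list_encode (map enc xs)"
instance by standard (simp add: enc_list_def list_encode_eq inj_map_eq_map inj_def)
end

lemma enc_simps [simp]:
  "enc (None :: 'a :: encodable option) = 0" "enc (Some x) = Suc (enc x)"
  "enc (x, y) = prod_encode (enc x, enc y)"
  "enc ([] :: 'a :: encodable list) = 0" "enc (x # xs) = Suc (prod_encode (enc x, enc xs))"
  by (simp_all add: enc_option_def enc_prod_def enc_list_def)

text \<open>The codes of \<open>option\<close> and \<open>list\<close> are chosen to make this hold: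
  what a learner reads is then the standard code of a sequence.\<close>

lemma enc_eq_seq_code: "enc \<sigma> = seq_code \<sigma>"
  by (simp add: seq_code_def enc_list_def enc_option_def[abs_def] cong: option.case_cong)

section \<open>Computable functions between coded data types\<close>

text \<open>The realiser \<open>F\<close> is constrained only on codes; \<open>enc\<close> is merely
  injective in general, so other numbers may occur.\<close>

definition computable :: "('a :: encodable \<Rightarrow> 'b :: encodable) \<Rightarrow> bool" where
  "computable f \<longleftrightarrow> (\<exists>F. unary_rec F \<and> (\<forall>x. F (enc x) = enc (f x)))"

lemma computable_comp:
  assumes "computable g" "computable f" shows "computable (\<lambda>x. g (f x))"
proof -
  obtain G F where "unary_rec G" "\<And>x. G (enc x) = enc (g x)" "unary_rec F" "\<And>x. F (enc x) = enc (f x)"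
    using assms unfolding computable_def by blast
  then show ?thesis
    unfolding computable_def by (intro exI[of _ "\<lambda>n. G (F n)"]) (simp add: unary_rec_comp)
qed

named_theorems computable_intros

lemma computable_id [computable_intros]: "computable (\<lambda>x. x)"
  unfolding computable_def by (intro exI[of _ "\<lambda>n. n"]) (simp add: unary_rec_id)

lemma computable_const [computable_intros]: "computable (\<lambda>x. c)"
  unfolding computable_def by (intro exI[of _ "\<lambda>n. enc c"]) (simp add: unary_rec_const)

lemma computable_enc [computable_intros]:
  "computable f \<Longrightarrow> computable (\<lambda>x. enc (f x))"
  unfolding computable_def by simp

lemma computable_Pair [computable_intros]:
  assumes "computable f" "computable g" shows "computable (\<lambda>x. (f x, g x))"
proof -
  obtain G F where "unary_rec G" "\<And>x. G (enc x) = enc (g x)" "unary_rec F" "\<And>x. F (enc x) = enc (f x)"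
    using assms unfolding computable_def by blast
  then show ?thesis
    unfolding computable_def
    by (intro exI[of _ "\<lambda>n. prod_encode (F n, G n)"]) (simp add: unary_rec_prod_encode)
qed

lemma computable_unary:
  assumes "unary_rec F" "\<And>x. F (enc x) = enc (g x)" "computable f"
  shows "computable (\<lambda>x. g (f x))"
  by (rule computable_comp[OF _ assms(3)]) (use assms(1,2) in \<open>auto simp: computable_def\<close>)

lemma computable_fst [computable_intros]: "computable f \<Longrightarrow> computable (\<lambda>x. fst (f x))"
  and computable_snd [computable_intros]: "computable f \<Longrightarrow> computable (\<lambda>x. snd (f x))"
  and computable_Suc [computable_intros]: "computable g \<Longrightarrow> computable (\<lambda>x. Suc (g x))"
  and computable_Some [computable_intros]: "computable h \<Longrightarrow> computable (\<lambda>x. Some (h x))"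
     apply (rule computable_unary[where F = "\<lambda>n. fst (prod_decode n)"];
         simp add: unary_rec_intros enc_prod_def)
    apply (rule computable_unary[where F = "\<lambda>n. snd (prod_decode n)"];
      simp add: unary_rec_intros enc_prod_def)
   apply (rule computable_unary[where F = Suc]; simp add: unary_rec_intros)
  apply (rule computable_unary[where F = Suc]; simp add: unary_rec_intros)
  done

lemma computable_app2:
  assumes "computable (\<lambda>p. f (fst p) (snd p))" "computable g" "computable h"
  shows "computable (\<lambda>x. f (g x) (h x))"
  using computable_comp[OF assms(1) computable_Pair[OF assms(2,3)]] by simp

lemma computable_app3:
  assumes "computable (\<lambda>p. f (fst p) (fst (snd p)) (snd (snd p)))"
    "computable g" "computable h" "computable k"
  shows "computable (\<lambda>x. f (g x) (h x) (k x))"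
  using computable_comp[OF assms(1) computable_Pair[OF assms(2) computable_Pair[OF assms(3,4)]]]
  by simp

lemma computable_if [computable_intros]:
  assumes "computable p" "computable f" "computable g"
  shows "computable (\<lambda>x. if p x then f x else g x)"
proof -
  obtain P F G where "unary_rec P" "\<And>x. P (enc x) = enc (p x)"
    "unary_rec F" "\<And>x. F (enc x) = enc (f x)" "unary_rec G" "\<And>x. G (enc x) = enc (g x)"
    using assms unfolding computable_def by blast
  then show ?thesis
    unfolding computable_def
    by (intro exI[of _ "\<lambda>n. if P n = 0 then G n else F n"]) (simp add: unary_rec_if_zero)
qed

lemma computable_not [computable_intros]:
  assumes "computable p" shows "computable (\<lambda>x. \<not> p x)"
proof -
  have "(\<lambda>x. \<not> p x) = (\<lambda>x. if p x then False else True)" by auto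
  then show ?thesis using assms by (simp only:) (intro computable_intros)
qed

lemma computable_conj [computable_intros]:
  assumes "computable p" "computable q" shows "computable (\<lambda>x. p x \<and> q x)"
proof -
  have "(\<lambda>x. p x \<and> q x) = (\<lambda>x. if p x then q x else False)" by auto
  then show ?thesis using assms by (simp only:) (intro computable_intros)
qed

lemma computable_eq [computable_intros]:
  assumes "computable f" "computable g" shows "computable (\<lambda>x. f x = g x)"
proof -
  obtain G F where "unary_rec G" "\<And>x. G (enc x) = enc (g x)" "unary_rec F" "\<And>x. F (enc x) = enc (f x)"
    using assms unfolding computable_def by blast
  then show ?thesis
    unfolding computable_def
    by (intro exI[of _ "\<lambda>n. if F n = G n then 1 else 0"]) (simp add: unary_rec_intros)
qed

lemma computable_case_option [computable_intros]:
  assumes "computable u" "computable f" "computable (\<lambda>p. g (fst p) (snd p))"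
  shows "computable (\<lambda>x. case u x of None \<Rightarrow> f x | Some y \<Rightarrow> g x y)"
proof -
  obtain U F G where *: "unary_rec U" "\<And>x. U (enc x) = enc (u x)"
    "unary_rec F" "\<And>x. F (enc x) = enc (f x)"
    "unary_rec G" "\<And>p. G (enc p) = enc (g (fst p) (snd p))"
    using assms unfolding computable_def by blast
  let ?H = "\<lambda>n. if U n = 0 then F n else G (prod_encode (n, U n - 1))"
  have "unary_rec ?H"
    by (intro unary_rec_intros unary_rec_comp[OF *(5)] *(1,3))
  moreover have "?H (enc x) = enc (case u x of None \<Rightarrow> f x | Some y \<Rightarrow> g x y)" for x
    using *(6)[of "(x, the (u x))"] by (cases "u x") (simp_all add: *)
  ultimately show ?thesis unfolding computable_def by blast
qed

lemma computable_Cons [computable_intros]: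
  assumes "computable f" "computable g" shows "computable (\<lambda>x. f x # g x)"
proof -
  obtain G F where "unary_rec G" "\<And>x. G (enc x) = enc (g x)" "unary_rec F" "\<And>x. F (enc x) = enc (f x)"
    using assms unfolding computable_def by blast
  then show ?thesis
    unfolding computable_def
    by (intro exI[of _ "\<lambda>n. Suc (prod_encode (F n, G n))"]) (simp add: unary_rec_intros)
qed

lemma computable_case_list [computable_intros]:
  assumes "computable u" "computable f" "computable (\<lambda>p. g (fst p) (fst (snd p)) (snd (snd p)))"
  shows "computable (\<lambda>x. case u x of [] \<Rightarrow> f x | y # ys \<Rightarrow> g x y ys)"
proof -
  obtain U F G where *: "unary_rec U" "\<And>x. U (enc x) = enc (u x)"
    "unary_rec F" "\<And>x. F (enc x) = enc (f x)"
    "unary_rec G" "\<And>p. G (enc p) = enc (g (fst p) (fst (snd p)) (snd (snd p)))"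
    using assms unfolding computable_def by blast
  let ?H = "\<lambda>n. if U n = 0 then F n else G (prod_encode (n, U n - 1))"
  have "unary_rec ?H"
    by (intro unary_rec_intros unary_rec_comp[OF *(5)] *(1,3))
  moreover have "?H (enc x) = enc (case u x of [] \<Rightarrow> f x | y # ys \<Rightarrow> g x y ys)" for x
    using *(6)[of "(x, hd (u x), tl (u x))"] by (cases "u x") (simp_all add: *)
  ultimately show ?thesis unfolding computable_def by blast
qed

lemma computable_rec_nat [computable_intros]:
  assumes "computable a" "computable k" "computable (\<lambda>p. s (fst p) (fst (snd p)) (snd (snd p)))"
  shows "computable (\<lambda>x. rec_nat (a x) (s x) (k x))"
proof -
  obtain A K S where *: "unary_rec A" "\<And>x. A (enc x) = enc (a x)"
    "unary_rec K" "\<And>x. K (enc x) = enc (k x)"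
    "unary_rec S" "\<And>p. S (enc p) = enc (s (fst p) (fst (snd p)) (snd (snd p)))"
    using assms unfolding computable_def by blast
  let ?H = "\<lambda>n. rec_nat (A n) (\<lambda>i r. S (prod_encode (n, prod_encode (i, r)))) (K n)"
  have "unary_rec ?H" by (intro unary_rec_rec_nat *)
  moreover have "rec_nat (A (enc x)) (\<lambda>i r. S (prod_encode (enc x, prod_encode (i, r)))) j
      = enc (rec_nat (a x) (s x) j)" for x j
  proof (induction j)
    case (Suc j)
    show ?case using *(6)[of "(x, j, rec_nat (a x) (s x) j)"] by (simp add: Suc)
  qed (simp add: *)
  ultimately show ?thesis
    unfolding computable_def by (intro exI[of _ ?H]) (simp add: *(4))
qed

lemma length_le_enc: "length xs \<le> enc xs"
proof (induction xs)
  case (Cons x xs)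
  then show ?case using le_prod_encode_2[of "enc xs" "enc x"] by simp
qed simp

text \<open>The code of a list bounds its length, so it can serve as the number of iterations.\<close>
lemma foldl_rec_nat:
  "foldl f a xs = fst (rec_nat (a, xs)
     (\<lambda>_ p. case snd p of [] \<Rightarrow> p | y # ys \<Rightarrow> (f (fst p) y, ys)) (enc xs))"
proof -
  have "rec_nat (a, xs) (\<lambda>_ p. case snd p of [] \<Rightarrow> p | y # ys \<Rightarrow> (f (fst p) y, ys)) n
      = (foldl f a (take n xs), drop n xs)" for n
  proof (induction n)
    case (Suc n)
    show ?case
    proof (cases "n < length xs")
      case True
      then have "drop n xs = xs ! n # drop (Suc n) xs" by (simp add: Cons_nth_drop_Suc)
      with True show ?thesis by (simp add: Suc take_Suc_conv_app_nth)
    qed (simp add: Suc)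
  qed simp
  then show ?thesis by (simp add: length_le_enc)
qed

lemma computable_foldl [computable_intros]:
  assumes "computable a" "computable l" "computable (\<lambda>p. f (fst p) (fst (snd p)) (snd (snd p)))"
  shows "computable (\<lambda>x. foldl (f x) (a x) (l x))"
  unfolding foldl_rec_nat
  by (intro computable_intros assms(1,2) computable_app3[OF assms(3)])

lemma computable_append [computable_intros]:
  assumes "computable f" "computable g" shows "computable (\<lambda>x. f x @ g x)"
proof -
  have rev_foldl: "foldl (\<lambda>r y. y # r) zs ys = rev ys @ zs" for ys zs :: "'b list"
    by (induction ys arbitrary: zs) simp_all
  \<comment> \<open>Consing onto an accumulator reverses a list; reversing \<open>f x\<close> twice,
    the second time onto \<open>g x\<close>, yields the append.\<close>
  have "computable (\<lambda>x. foldl (\<lambda>r y. y # r) (g x) (foldl (\<lambda>r y. y # r) [] (f x)))"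
    by (intro computable_intros assms)
  then show ?thesis by (simp add: rev_foldl)
qed

lemma computable_list_all [computable_intros]:
  assumes "computable l" "computable (\<lambda>p. P (fst p) (snd p))"
  shows "computable (\<lambda>x. list_all (P x) (l x))"
proof -
  have eq: "foldl (\<lambda>b y. if b then Q y else False) c ys = (c \<and> list_all Q ys)" for Q c ys
    by (induction ys arbitrary: c) auto
  have "computable (\<lambda>x. foldl (\<lambda>b y. if b then P x y else False) True (l x))"
    by (intro computable_intros computable_app2[OF assms(2)] assms(1))
  then show ?thesis by (simp add: eq)
qed

lemma computable_member [computable_intros]:
  assumes "computable f" "computable l" shows "computable (\<lambda>x. f x \<in> set (l x))"
proof -
  have "computable (\<lambda>x. \<not> list_all (\<lambda>y. y \<noteq> f x) (l x))"
    by (intro computable_intros computable_comp[OF assms(1)] assms(2))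
  moreover have "(\<not> list_all (\<lambda>y. y \<noteq> a) ys) = (a \<in> set ys)" for a :: 'b and ys
    by (auto simp: list_all_iff)
  ultimately show ?thesis by simp
qed

lemma computable_length [computable_intros]:
  assumes "computable l" shows "computable (\<lambda>x. length (l x))"
proof -
  have "foldl (\<lambda>n _. Suc n) k ys = k + length ys" for k and ys :: "'b list"
    by (induction ys arbitrary: k) simp_all
  moreover have "computable (\<lambda>x. foldl (\<lambda>n _. Suc n) 0 (l x))"
    by (intro computable_intros assms)
  ultimately show ?thesis by simp
qed

lemma computable_disj [computable_intros]:
  assumes "computable p" "computable q" shows "computable (\<lambda>x. p x \<or> q x)"
proof -
  have "(\<lambda>x. p x \<or> q x) = (\<lambda>x. if p x then True else q x)" by auto
  then show ?thesis using assms by (simp only:) (intro computable_intros)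
qed

lemma computable_fst_prod_decode [computable_intros]:
  assumes "computable f" shows "computable (\<lambda>x. fst (prod_decode (f x)))"
  by (rule computable_unary[OF unary_rec_fst[OF unary_rec_id] _ assms]) simp

lemma computable_snd_prod_decode [computable_intros]:
  assumes "computable f" shows "computable (\<lambda>x. snd (prod_decode (f x)))"
  by (rule computable_unary[OF unary_rec_snd[OF unary_rec_id] _ assms]) simp

lemma computable_prod_encode [computable_intros]:
  assumes "computable f" "computable g" shows "computable (\<lambda>x. prod_encode (f x, g x))"
  using computable_enc[OF computable_Pair[OF assms]] by simp

text \<open>A primitive recursion that keeps the first hit; bounded quantifiers are later read off
  from whether the search fails.\<close>

definition bounded_search :: "(nat \<Rightarrow> bool) \<Rightarrow> nat \<Rightarrow> nat option" where
  "bounded_search P n =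
    rec_nat None (\<lambda>k r. case r of None \<Rightarrow> if P k then Some k else None | Some j \<Rightarrow> Some j) n"

lemma bounded_search_simps:
  "bounded_search P 0 = None"
  "bounded_search P (Suc n) =
    (case bounded_search P n of None \<Rightarrow> if P n then Some n else None | Some k \<Rightarrow> Some k)"
  by (simp_all add: bounded_search_def)

lemma bounded_search_eq_None_iff: "bounded_search P n = None \<longleftrightarrow> (\<forall>k<n. \<not> P k)"
  by (induction n) (auto simp: bounded_search_simps less_Suc_eq split: option.splits)

lemma bounded_search_eq_Some_iff:
  "bounded_search P n = Some k \<longleftrightarrow> k < n \<and> P k \<and> (\<forall>j<k. \<not> P j)"
proof (induction n arbitrary: k)
  case (Suc n)
  show ?case
  proof (cases "bounded_search P n")
    case None
    then have "\<forall>k<n. \<not> P k" by (simp add: bounded_search_eq_None_iff)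
    with None show ?thesis by (auto simp: bounded_search_simps less_Suc_eq)
  next
    case (Some j)
    then have "j < n" "P j" "\<forall>i<j. \<not> P i"
      using Suc by blast+
    then show ?thesis
      using Some by (auto simp: bounded_search_simps less_Suc_eq) (metis less_trans linorder_neqE_nat)+
  qed
qed (simp add: bounded_search_simps)

lemma computable_bounded_search [computable_intros]:
  assumes "computable k" "computable (\<lambda>p. P (fst p) (snd p))"
  shows "computable (\<lambda>x. bounded_search (P x) (k x))"
  unfolding bounded_search_def
  by (intro computable_intros computable_app2[OF assms(2)] assms(1))

lemma computable_bind [computable_intros]:
  assumes "computable u" "computable (\<lambda>p. f (fst p) (snd p))"
  shows "computable (\<lambda>x. Option.bind (u x) (f x))"
proof -
  have "Option.bind v g = (case v of None \<Rightarrow> None | Some y \<Rightarrow> g y)" for v :: "'b option" and g :: "'b \<Rightarrow> 'c option"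
    by (cases v) simp_all
  then show ?thesis by (simp only:) (intro computable_intros computable_app2[OF assms(2)] assms(1))
qed

lemma computable_all_less [computable_intros]:
  fixes k :: "'a :: encodable \<Rightarrow> nat"
  assumes "computable k" "computable (\<lambda>p. P (fst p) (snd p))"
  shows "computable (\<lambda>x. \<forall>i<k x. P x i)"
proof -
  have "computable (\<lambda>x. bounded_search (\<lambda>i. \<not> P x i) (k x) = None)"
    by (intro computable_intros computable_app2[OF assms(2)] assms(1))
  then show ?thesis by (simp add: bounded_search_eq_None_iff)
qed

text \<open>The index \<open>i\<close> is a fixed number, so \<open>drop i\<close> is a constant
  number of tails; the default \<open>d\<close> settles access past the end.\<close>

lemma computable_nth_default [computable_intros]:
  assumes "computable l"
  shows "computable (\<lambda>x. case drop i (l x) of [] \<Rightarrow> d | y # _ \<Rightarrow> y)"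
proof -
  have "drop i ys = rec_nat ys (\<lambda>_ zs. case zs of [] \<Rightarrow> [] | _ # us \<Rightarrow> us) i" for ys :: "'b list"
  proof (induction i)
    case (Suc i)
    have "drop (Suc i) ys = tl (drop i ys)" by (metis drop_Suc tl_drop)
    then show ?case by (simp add: Suc tl_def)
  qed simp
  then show ?thesis by (simp only:) (intro computable_intros assms)
qed

section \<open>Step-bounded approximation of partial recursive functions\<close>

text \<open>Stages may be silent for a while but never retract a value, and a divergent computation
  stays \<open>None\<close> at every stage.\<close>

definition approximates :: "(nat \<Rightarrow> 'a option) \<Rightarrow> 'a option \<Rightarrow> bool" where
  "approximates a v \<longleftrightarrow>
     (\<forall>t t' y. a t = Some y \<longrightarrow> t \<le> t' \<longrightarrow> a t' = Some y) \<and> (\<forall>y. v = Some y \<longleftrightarrow> (\<exists>t. a t = Some y))"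

lemma approximates_mono: "approximates a v \<Longrightarrow> a t = Some y \<Longrightarrow> t \<le> t' \<Longrightarrow> a t' = Some y"
  and approximates_sound: "approximates a v \<Longrightarrow> a t = Some y \<Longrightarrow> v = Some y"
  unfolding approximates_def by blast+

text \<open>Phrased with a filter, so that finitely many approximations can be brought to a common
  stage.\<close>

lemma approximates_eventually:
  "approximates a v \<Longrightarrow> v = Some y \<Longrightarrow> \<forall>\<^sub>F t in sequentially. a t = Some y"
  unfolding approximates_def eventually_sequentially by blast

lemma approximatesI:
  assumes "\<And>t t' y. a t = Some y \<Longrightarrow> t \<le> t' \<Longrightarrow> a t' = Some y"
    and "\<And>t y. a t = Some y \<Longrightarrow> v = Some y"
    and "\<And>y. v = Some y \<Longrightarrow> \<exists>t. a t = Some y"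
  shows "approximates a v"
  using assms unfolding approximates_def by blast

lemma approximates_const: "approximates (\<lambda>t. v) v"
  by (rule approximatesI) auto

lemma approximates_bind:
  assumes a: "approximates a v" and b: "\<And>y. v = Some y \<Longrightarrow> approximates (\<lambda>t. b t y) (c y)"
  shows "approximates (\<lambda>t. Option.bind (a t) (b t)) (Option.bind v c)"
proof (rule approximatesI)
  fix t z assume "Option.bind (a t) (b t) = Some z"
  then obtain y where y: "a t = Some y" "b t y = Some z" by (auto simp: bind_eq_Some_conv)
  have v: "v = Some y" using approximates_sound[OF a y(1)] .
  show "Option.bind v c = Some z" using v approximates_sound[OF b[OF v] y(2)] by simp
  fix t' assume "t \<le> t'"
  then show "Option.bind (a t') (b t') = Some z"
    using approximates_mono[OF a y(1)] approximates_mono[OF b[OF v] y(2)] by simp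
next
  fix z assume "Option.bind v c = Some z"
  then obtain y where y: "v = Some y" "c y = Some z" by (auto simp: bind_eq_Some_conv)
  have "\<forall>\<^sub>F t in sequentially. a t = Some y \<and> b t y = Some z"
    using approximates_eventually[OF a y(1)] approximates_eventually[OF b[OF y(1)] y(2)]
    by (rule eventually_conj)
  then obtain t where "a t = Some y \<and> b t y = Some z"
    using eventually_happens'[OF sequentially_bot] by blast
  then show "\<exists>t. Option.bind (a t) (b t) = Some z" by (intro exI[of _ t]) simp
qed

text \<open>A hit at stage \<open>t\<close> carries values for all smaller arguments, so a smaller
  true zero would already be visible at stage \<open>t\<close>. Hence every reported value is the
  true one.\<close>

lemma approximates_mu:
  assumes A: "\<And>y. approximates (\<lambda>t. A t (y # xs)) (f (y # xs))"
  shows "approximates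
    (\<lambda>t. bounded_search (\<lambda>y. A t (y # xs) = Some 0 \<and> (\<forall>z<y. A t (z # xs) \<noteq> None)) t) (mu f xs)"
    (is "approximates ?a _")
proof -
  let ?Q = "\<lambda>y. f (y # xs) = Some 0 \<and> (\<forall>z<y. f (z # xs) \<noteq> None)"
  let ?Qt = "\<lambda>t y. A t (y # xs) = Some 0 \<and> (\<forall>z<y. A t (z # xs) \<noteq> None)"
  have sound: "A t (y # xs) = Some v \<Longrightarrow> f (y # xs) = Some v" for t y v
    using approximates_sound[OF A] .
  have QtQ: "?Q y" if "?Qt t y" for t y
  proof (intro conjI allI impI)
    show "f (y # xs) = Some 0" using that sound by blast
    fix z assume "z < y"
    then obtain v where "A t (z # xs) = Some v" using \<open>?Qt t y\<close> by blast
    then show "f (z # xs) \<noteq> None" using sound by blast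
  qed
  have mu_eq: "mu f xs = Some y" if "?a t = Some y" for t y
  proof -
    from that have y: "?Qt t y" "\<forall>j<y. \<not> ?Qt t j" unfolding bounded_search_eq_Some_iff by blast+
    have "\<not> ?Q j" if j: "j < y" for j
    proof
      assume Q: "?Q j"
      obtain v where v: "A t (j # xs) = Some v" using y(1) j by blast
      then have "v = 0" using sound[OF v] Q by simp
      then have "?Qt t j" using v y(1) j by (metis less_trans)
      then show False using y(2) j by blast
    qed
    then have "(LEAST y. ?Q y) = y"
      by (intro Least_equality QtQ[OF y(1)]) (metis not_le)
    then show ?thesis using QtQ[OF y(1)] unfolding mu_def by metis
  qed
  have found: "\<exists>k. ?a t = Some k" if "?Qt t y" "y < t" for t y
  proof -
    have "?a t \<noteq> None" unfolding bounded_search_eq_None_iff using that by blast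
    then show ?thesis by blast
  qed
  show ?thesis
  proof (rule approximatesI)
    fix t y assume y: "?a t = Some y"
    show mu: "mu f xs = Some y" by (rule mu_eq[OF y])
    fix t' assume "t \<le> t'"
    have mono: "A t (z # xs) = Some v \<Longrightarrow> A t' (z # xs) = Some v" for z v
      using approximates_mono[OF A _ \<open>t \<le> t'\<close>] .
    have "?Qt t y" "y < t" using y unfolding bounded_search_eq_Some_iff by blast+
    then have "?Qt t' y" "y < t'" using mono \<open>t \<le> t'\<close> by (blast, simp)
    \<comment> \<open>The search at \<open>t'\<close> succeeds with some \<open>k\<close>, and both
      results equal the value of \<open>mu\<close>.\<close>
    from found[OF this] obtain k where k: "?a t' = Some k" by blast
    then show "?a t' = Some y" using mu_eq[OF k] mu by simp
  next
    fix y assume mu: "mu f xs = Some y"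
    have ex: "\<exists>y. ?Q y"
    proof (rule ccontr)
      assume "\<not> ?thesis"
      then have "mu f xs = None" unfolding mu_def by (rule if_not_P)
      with mu show False by simp
    qed
    have "mu f xs = Some (LEAST y. ?Q y)" unfolding mu_def using ex by (rule if_P)
    then have "(LEAST y. ?Q y) = y" using mu by (simp only: option.inject)
    then have Q: "?Q y" by (rule subst[where P = ?Q, OF _ LeastI_ex[OF ex]])
    \<comment> \<open>Only finitely many computations are involved, so some stage beyond
      \<open>y\<close> shows all of them.\<close>
    have 1: "\<forall>\<^sub>F t in sequentially. A t (y # xs) = Some 0"
      using Q approximates_eventually[OF A] by blast
    have "\<forall>\<^sub>F t in sequentially. A t (z # xs) \<noteq> None" if z: "z \<in> {..<y}" for z
    proof -
      obtain v where "f (z # xs) = Some v" using Q z by auto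
      from approximates_eventually[OF A this] show ?thesis by eventually_elim simp
    qed
    then have 2: "\<forall>\<^sub>F t in sequentially. \<forall>z\<in>{..<y}. A t (z # xs) \<noteq> None"
      by (intro eventually_ball_finite) auto
    obtain t where "?Qt t y" "y < t"
      using eventually_happens'[OF sequentially_bot
          eventually_conj[OF 1 eventually_conj[OF 2 eventually_gt_at_top[of y]]]]
      by blast
    from found[OF this] obtain k where k: "?a t = Some k" by blast
    then show "\<exists>t. ?a t = Some y" using mu_eq[OF k] mu by auto
  qed
qed

text \<open>Induction on the derivation builds a total step-bounded evaluator, computable jointly in
  the stage and the argument list.\<close>

lemma partrec_approximation:
  "partrec n f \<Longrightarrow> \<exists>A. computable (\<lambda>p. A (fst p) (snd p)) \<and>
     (\<forall>xs. length xs = n \<longrightarrow> approximates (\<lambda>t. A t xs) (f xs))"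
proof (induction rule: partrec.induct)
  case (zero n)
  show ?case
    by (rule exI[of _ "\<lambda>t xs. Some 0"]) (simp add: approximates_const computable_intros)
next
  case succ
  have "computable (\<lambda>p::nat \<times> nat list. Some (Suc (case drop 0 (snd p) of [] \<Rightarrow> 0 | y # _ \<Rightarrow> y)))"
    by (intro computable_intros)
  then show ?case
    by (intro exI[of _ "\<lambda>t xs. Some (Suc (case drop 0 xs of [] \<Rightarrow> 0 | y # _ \<Rightarrow> y))"])
      (auto simp: length_Suc_conv approximates_const)
next
  case (proj i n)
  have "computable (\<lambda>p::nat \<times> nat list. Some (case drop i (snd p) of [] \<Rightarrow> 0 | y # _ \<Rightarrow> y))"
    by (intro computable_intros)
  moreover have "(case drop i xs of [] \<Rightarrow> 0 | y # _ \<Rightarrow> y) = xs ! i" if "length xs = n" for xs :: "nat list"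
    using proj that by (metis Cons_nth_drop_Suc list.simps(5))
  ultimately show ?case
    by (intro exI[of _ "\<lambda>t xs. Some (case drop i xs of [] \<Rightarrow> 0 | y # _ \<Rightarrow> y)"])
      (simp add: approximates_const)
next
  case (comp m f gs n)
  \<comment> \<open>Composition is split in two: first the list of inner values, undefined if any
    component is, and then \<open>f\<close> applied to it.\<close>
  let ?values = "\<lambda>gs xs. if \<forall>g\<in>set gs. g xs \<noteq> None then Some (map (\<lambda>g. the (g xs)) gs) else None"
  have "\<exists>B. computable (\<lambda>p. B (fst p) (snd p)) \<and>
      (\<forall>xs. length xs = n \<longrightarrow> approximates (\<lambda>t. B t xs) (?values gs xs))"
    using comp.IH(2)
  proof (induction gs)
    case Nil
    show ?case
      by (rule exI[of _ "\<lambda>t xs. Some []"]) (simp add: approximates_const computable_intros)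
  next
    case (Cons g gs)
    obtain B where B: "computable (\<lambda>p. B (fst p) (snd p))"
      "\<And>xs. length xs = n \<Longrightarrow> approximates (\<lambda>t. B t xs) (?values gs xs)"
      using Cons by auto
    obtain C where C: "computable (\<lambda>p. C (fst p) (snd p))"
      "\<And>xs. length xs = n \<Longrightarrow> approximates (\<lambda>t. C t xs) (g xs)"
      using Cons.prems by auto
    let ?B = "\<lambda>t xs. Option.bind (C t xs) (\<lambda>y. Option.bind (B t xs) (\<lambda>ys. Some (y # ys)))"
    have "computable (\<lambda>p. ?B (fst p) (snd p))"
      by (intro computable_intros computable_app2[OF B(1)] computable_app2[OF C(1)])
    moreover have "approximates (\<lambda>t. ?B t xs) (?values (g # gs) xs)" if "length xs = n" for xs
    proof -
      have "?values (g # gs) xs =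
          Option.bind (g xs) (\<lambda>y. Option.bind (?values gs xs) (\<lambda>ys. Some (y # ys)))"
        by (cases "g xs") auto
      then show ?thesis
        by (simp only:) (intro approximates_bind approximates_const B(2) C(2) that)
    qed
    ultimately show ?case by (intro exI[of _ ?B] conjI allI impI)
  qed
  then obtain B where B: "computable (\<lambda>p. B (fst p) (snd p))"
    "\<And>xs. length xs = n \<Longrightarrow> approximates (\<lambda>t. B t xs) (?values gs xs)"
    by blast
  obtain C where C: "computable (\<lambda>p. C (fst p) (snd p))"
    "\<And>xs. length xs = m \<Longrightarrow> approximates (\<lambda>t. C t xs) (f xs)"
    using comp.IH(1) by blast
  let ?A = "\<lambda>t xs. Option.bind (B t xs) (C t)"
  have "computable (\<lambda>p. ?A (fst p) (snd p))"
    by (intro computable_intros computable_app2[OF B(1)] computable_app2[OF C(1)])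
  moreover have "approximates (\<lambda>t. ?A t xs)
      (if \<forall>g\<in>set gs. g xs \<noteq> None then f (map (\<lambda>g. the (g xs)) gs) else None)" if "length xs = n" for xs
  proof -
    have "(if \<forall>g\<in>set gs. g xs \<noteq> None then f (map (\<lambda>g. the (g xs)) gs) else None)
        = Option.bind (?values gs xs) f"
      by auto
    then show ?thesis
      using comp.hyps(2)
      by (simp only:) (intro approximates_bind B(2) C(2) that, auto split: if_splits)
  qed
  ultimately show ?case by (intro exI[of _ ?A] conjI allI impI)
next
  case (prim_rec n g h)
  obtain B where B: "computable (\<lambda>p. B (fst p) (snd p))"
    "\<And>xs. length xs = n \<Longrightarrow> approximates (\<lambda>t. B t xs) (g xs)"
    using prim_rec.IH(1) by blast
  obtain C where C: "computable (\<lambda>p. C (fst p) (snd p))"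
    "\<And>xs. length xs = Suc (Suc n) \<Longrightarrow> approximates (\<lambda>t. C t xs) (h xs)"
    using prim_rec.IH(2) by blast
  let ?R = "\<lambda>t k xs. rec_nat (B t xs) (\<lambda>i u. Option.bind u (\<lambda>r. C t (i # r # xs))) k"
  \<comment> \<open>The value on \<open>[]\<close> is a dummy, as the arity is
    \<open>Suc n\<close>.\<close>
  let ?A = "\<lambda>t xs. case xs of [] \<Rightarrow> None | k # ys \<Rightarrow> ?R t k ys"
  have "computable (\<lambda>p. ?A (fst p) (snd p))"
    by (intro computable_intros computable_app2[OF B(1)] computable_app2[OF C(1)])
  moreover have "approximates (\<lambda>t. ?R t k xs) (prec g h k xs)" if "length xs = n" for k xs
  proof (induction k)
    case 0
    then show ?case using B(2)[OF that] by simp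
  next
    case (Suc k)
    show ?case
      unfolding prec.simps nat.rec
      by (intro approximates_bind[OF Suc] C(2)) (simp add: that)
  qed
  ultimately show ?case
    by (intro exI[of _ ?A]) (auto simp: length_Suc_conv)
next
  case (minimize n f)
  obtain B where B: "computable (\<lambda>p. B (fst p) (snd p))"
    "\<And>xs. length xs = Suc n \<Longrightarrow> approximates (\<lambda>t. B t xs) (f xs)"
    using minimize.IH by blast
  let ?A = "\<lambda>t xs. bounded_search (\<lambda>y. B t (y # xs) = Some 0 \<and> (\<forall>z<y. B t (z # xs) \<noteq> None)) t"
  have "computable (\<lambda>p. ?A (fst p) (snd p))"
    by (intro computable_intros computable_app2[OF B(1)])
  moreover have "approximates (\<lambda>t. ?A t xs) (mu f xs)" if "length xs = n" for xs
    by (intro approximates_mu B(2)) (simp add: that)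
  ultimately show ?case by (intro exI[of _ ?A] conjI allI impI)
qed

lemma pcomputable_approximation:
  assumes "pcomputable f"
  obtains A :: "nat \<Rightarrow> nat \<Rightarrow> nat option"
  where "computable (\<lambda>p. A (fst p) (snd p))" "\<And>x. approximates (\<lambda>t. A t x) (f x)"
proof -
  obtain F where F: "partrec 1 F" "\<And>x. f x = F [x]"
    using assms unfolding pcomputable_def by blast
  obtain A where A: "computable (\<lambda>p. A (fst p) (snd p))"
    "\<And>xs. length xs = 1 \<Longrightarrow> approximates (\<lambda>t. A t xs) (F xs)"
    using partrec_approximation[OF F(1)] by blast
  have "computable (\<lambda>p. A (fst p) [snd p])"
    by (intro computable_intros computable_app2[OF A(1)])
  then show thesis using A(2) F(2) by (intro that[of "\<lambda>t x. A t [x]"]) auto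
qed

section \<open>From computable functions back to partial recursive ones\<close>

lemma computable_unary_rec:
  fixes f :: "nat \<Rightarrow> nat"
  assumes "computable f" shows "unary_rec f"
proof -
  obtain F where "unary_rec F" "\<forall>x. F x = f x"
    using assms unfolding computable_def by auto
  moreover from this(2) have "F = f" by blast
  ultimately show ?thesis by simp
qed

lemma Rfun_computable:
  fixes f :: "nat \<Rightarrow> nat"
  assumes "computable f" shows "(\<lambda>x. Some (f x)) \<in> Rfun"
proof -
  obtain g where g: "partrec 1 g" "\<And>xs. length xs = 1 \<Longrightarrow> g xs = Some (f (xs ! 0))"
    using computable_unary_rec[OF assms] unfolding unary_rec_def total_rec_def by blast
  have "Some (f x) = g [x]" for x using g(2)[of "[x]"] by simp
  with g(1) show ?thesis unfolding Rfun_def pcomputable_def by blast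
qed

text \<open>Unbounded search semi-decides \<open>\<exists>t. P t x\<close>; this later turns the
  stages of the hypotheses into a numbering.\<close>

lemma pcomputable_search:
  fixes P :: "nat \<Rightarrow> nat \<Rightarrow> bool"
  assumes "computable (\<lambda>p. P (fst p) (snd p))"
  shows "pcomputable (\<lambda>x. if \<exists>t. P t x then Some (LEAST t. P t x) else None)"
proof -
  have "computable (\<lambda>p. if P (fst p) (snd p) then 0 else 1 :: nat)"
    by (intro computable_intros assms)
  then obtain F where F: "unary_rec F" "\<And>p. F (enc p) = enc (if P (fst p) (snd p) then 0 else 1 :: nat)"
    unfolding computable_def by blast
  have "total_rec 2 (\<lambda>xs. F (prod_encode (xs ! 0, xs ! 1)))"
    by (intro unary_rec_total_rec[OF F(1)] rec_intros; simp)
  then obtain g where g: "partrec 2 g"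
    "\<And>xs. length xs = 2 \<Longrightarrow> g xs = Some (F (prod_encode (xs ! 0, xs ! 1)))"
    unfolding total_rec_def by blast
  \<comment> \<open>\<open>g\<close> is defined on every \<open>[t, x]\<close> and zero exactly
    where \<open>P\<close> holds, so its minimisation finds the least \<open>t\<close>.\<close>
  have g_eq: "g [t, x] = Some (if P t x then 0 else 1)" for t x
    using g(2)[of "[t, x]"] F(2)[of "(t, x)"] by simp
  have "partrec 1 (mu g)"
    by (rule partrec.minimize) (use g(1) in \<open>simp add: numeral_2_eq_2\<close>)
  moreover have "mu g [x] = (if \<exists>t. P t x then Some (LEAST t. P t x) else None)" for x
    unfolding mu_def g_eq by simp
  ultimately show ?thesis unfolding pcomputable_def by (intro exI[of _ "mu g"]) simp
qed

section \<open>Sequences and texts\<close>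

text \<open>Every number codes a sequence, so searching for a sequence amounts to searching for a
  number.\<close>

definition decode_seq :: "nat \<Rightarrow> nat option list" where
  "decode_seq n = map (\<lambda>k. if k = 0 then None else Some (k - 1)) (list_decode n)"

lemma enc_decode_seq [simp]: "enc (decode_seq n) = n"
proof -
  have "(enc \<circ> (\<lambda>k. if k = 0 then None else Some (k - 1))) = id" by auto
  then show ?thesis by (simp add: decode_seq_def enc_list_def)
qed

lemma decode_seq_enc [simp]: "decode_seq (enc s) = s"
  by (rule enc_eq_iff[THEN iffD1]) (rule enc_decode_seq)

text \<open>On codes, decoding is the identity by \<open>enc_decode_seq\<close>.\<close>

lemma computable_decode_seq [computable_intros]:
  assumes "computable f" shows "computable (\<lambda>x. decode_seq (f x))"
  by (rule computable_unary[OF unary_rec_id _ assms]) simp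

text \<open>A decidable form of inclusion of contents; pauses carry no content and are
  skipped.\<close>

definition covers :: "nat option list \<Rightarrow> nat option list \<Rightarrow> bool" where
  "covers D F \<longleftrightarrow> list_all (\<lambda>c. c = None \<or> c \<in> set F) D"

lemma computable_covers [computable_intros]:
  assumes "computable D" "computable F" shows "computable (\<lambda>x. covers (D x) (F x))"
  unfolding covers_def
  by (intro computable_intros assms computable_comp[OF assms(2)])

lemma covers_iff: "covers D F \<longleftrightarrow> content_seq D \<subseteq> content_seq F"
  unfolding covers_def content_seq_def list_all_iff subset_iff by (auto, metis not_None_eq)

lemma content_seq_simps [simp]:
  "content_seq [] = {}" "content_seq (s @ s') = content_seq s \<union> content_seq s'"
  "content_seq (None # s) = content_seq s" "content_seq (Some x # s) = insert x (content_seq s)"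
  by (auto simp: content_seq_def)

lemma finite_content_seq [simp]: "finite (content_seq s)"
proof -
  have "Some ` content_seq s \<subseteq> set s" by (auto simp: content_seq_def)
  then show ?thesis by (meson finite_image_iff finite_set finite_subset inj_Some inj_on_subset subset_UNIV)
qed

lemma length_initseg [simp]: "length (initseg T n) = n"
  and initseg_Suc: "initseg T (Suc n) = initseg T n @ [T n]"
  and initseg_0 [simp]: "initseg T 0 = []"
  by (simp_all add: initseg_def)

lemma content_seq_initseg: "content_seq (initseg T n) = {x. \<exists>i<n. T i = Some x}"
  by (auto simp: content_seq_def initseg_def image_iff eq_commute[of "Some _"])

lemma content_seq_initseg_mono: "n \<le> m \<Longrightarrow> content_seq (initseg T n) \<subseteq> content_seq (initseg T m)"
  by (auto simp: content_seq_initseg dest: less_le_trans)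

lemma content_seq_initseg_subset: "content_seq (initseg T n) \<subseteq> content T"
  by (auto simp: content_seq_initseg content_def)

lemma eventually_content_initseg:
  assumes "finite F" "F \<subseteq> content T"
  shows "\<forall>\<^sub>F n in sequentially. F \<subseteq> content_seq (initseg T n)"
proof -
  have "\<forall>\<^sub>F n in sequentially. x \<in> content_seq (initseg T n)" if x: "x \<in> F" for x
  proof -
    obtain i where "T i = Some x" using assms(2) x by (auto simp: content_def)
    then have "x \<in> content_seq (initseg T n)" if "i < n" for n
      using that by (auto simp: content_seq_initseg)
    then show ?thesis by (rule eventually_mono[OF eventually_gt_at_top])
  qed
  then have "\<forall>\<^sub>F n in sequentially. \<forall>x\<in>F. x \<in> content_seq (initseg T n)"
    by (intro eventually_ball_finite assms(1)) blast
  then show ?thesis by (simp only: subset_eq)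
qed

definition prepend :: "nat option list \<Rightarrow> ltext \<Rightarrow> ltext" where
  "prepend s T i = (if i < length s then s ! i else T (i - length s))"

lemma initseg_prepend: "initseg (prepend s T) (length s + n) = s @ initseg T n"
  by (rule nth_equalityI) (auto simp: prepend_def initseg_def nth_append)

lemma content_prepend: "content (prepend s T) = content_seq s \<union> content T"
proof (intro equalityI subsetI)
  fix x assume "x \<in> content (prepend s T)"
  then show "x \<in> content_seq s \<union> content T"
    by (force simp: content_def prepend_def content_seq_def in_set_conv_nth split: if_splits)
next
  fix x assume "x \<in> content_seq s \<union> content T"
  then consider i where "i < length s" "s ! i = Some x" | i where "T i = Some x"
    by (auto simp: content_def content_seq_def in_set_conv_nth)
  then show "x \<in> content (prepend s T)"
  proof cases
    case (1 i)
    then show ?thesis by (auto simp: content_def prepend_def intro!: exI[of _ i])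
  next
    case (2 i)
    then show ?thesis by (auto simp: content_def prepend_def intro!: exI[of _ "length s + i"])
  qed
qed

section \<open>The witness-based learner\<close>

text \<open>\<open>hs\<close> approximates the given learner and \<open>ws\<close> the universal
  function of \<open>\<phi>\<close> on coded pairs. The construction consults only these total
  approximations, so it never waits for \<open>h\<close> to converge.\<close>

locale approximated_learner =
  fixes hs :: "nat \<Rightarrow> nat \<Rightarrow> nat option" and h :: "nat \<Rightarrow> nat option"
    and ws :: "nat \<Rightarrow> nat \<Rightarrow> nat option" and \<phi> :: "nat \<Rightarrow> nat \<Rightarrow> nat option"
  assumes hs_computable: "computable (\<lambda>p. hs (fst p) (snd p))"
    and hs_approx: "\<And>x. approximates (\<lambda>t. hs t x) (h x)"
    and ws_computable: "computable (\<lambda>p. ws (fst p) (snd p))"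
    and ws_approx: "\<And>e x. approximates (\<lambda>t. ws t (prod_encode (e, x))) (\<phi> e x)"
begin

section \<open>Hypotheses and states\<close>

definition enumerated :: "nat \<Rightarrow> nat \<Rightarrow> nat option list" where
  "enumerated e t =
     rec_nat [] (\<lambda>x r. if ws t (prod_encode (e, x)) \<noteq> None then Some x # r else r) t"

definition mind_change :: "nat \<Rightarrow> nat option list \<Rightarrow> nat option list \<Rightarrow> nat option list \<Rightarrow> bool" where
  "mind_change t s F \<rho> \<longleftrightarrow> covers \<rho> F \<and> hs t (enc s) \<noteq> None \<and> hs t (enc (s @ \<rho>)) \<noteq> None \<and>
     hs t (enc s) \<noteq> hs t (enc (s @ \<rho>))"

text \<open>\<open>t\<close> bounds both the running time and the code of the mind change, so the
  test is decidable.\<close>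

definition conflict :: "nat \<Rightarrow> nat option list \<Rightarrow> nat option list \<Rightarrow> nat option" where
  "conflict t s F = bounded_search (\<lambda>c. mind_change t s F (decode_seq c)) t"

definition stage :: "nat option list \<Rightarrow> nat \<Rightarrow> nat option list" where
  "stage s t = rec_nat s (\<lambda>t E. case hs t (enc s) of None \<Rightarrow> E
     | Some e \<Rightarrow> if covers s (enumerated e t) \<and> conflict t s (E @ enumerated e t) = None
                 then E @ enumerated e t else E) t"

definition hypothesis :: "nat option list \<Rightarrow> nat set" where
  "hypothesis s = (\<Union>t. content_seq (stage s t))"

definition update :: "nat option list \<Rightarrow> nat option list \<Rightarrow> nat option list" where
  "update \<sigma> s = (case conflict (length \<sigma>) s \<sigma> of None \<Rightarrow> s
     | Some c \<Rightarrow> if covers \<sigma> (stage s (length \<sigma>)) then s else s @ decode_seq c @ \<sigma>)"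

text \<open>The fold also carries the prefix read so far, because \<open>update\<close> needs all of
  it and not just the new symbol.\<close>

definition state :: "nat option list \<Rightarrow> nat option list" where
  "state \<sigma> = snd (foldl (\<lambda>p c. (fst p @ [c], update (fst p @ [c]) (snd p))) ([], []) \<sigma>)"

lemma state_Nil [simp]: "state [] = []"
  by (simp add: state_def)

lemma state_snoc: "state (\<sigma> @ [c]) = update (\<sigma> @ [c]) (state \<sigma>)"
proof -
  have "fst (foldl (\<lambda>p c. (fst p @ [c], update (fst p @ [c]) (snd p))) ([], []) \<sigma>) = \<sigma>"
    by (induction \<sigma> rule: rev_induct) simp_all
  then show ?thesis by (simp add: state_def)
qed

lemma content_enumerated:
  "content_seq (enumerated e t) = {x. x < t \<and> ws t (prod_encode (e, x)) \<noteq> None}"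
proof -
  \<comment> \<open>In \<open>enumerated\<close> the recursion length and the step bound coincide;
    the induction separates them.\<close>
  have "content_seq (rec_nat [] (\<lambda>x r. if ws t (prod_encode (e, x)) \<noteq> None then Some x # r else r) k)
      = {x. x < k \<and> ws t (prod_encode (e, x)) \<noteq> None}" for k
  proof (induction k)
    case (Suc k)
    have "{x. x < Suc k \<and> P x} = (if P k then insert k {x. x < k \<and> P x} else {x. x < k \<and> P x})"
      for P
      by (auto simp: less_Suc_eq)
    with Suc show ?case by simp
  qed simp
  then show ?thesis unfolding enumerated_def .
qed

lemma content_enumerated_subset: "content_seq (enumerated e t) \<subseteq> W \<phi> e"
  unfolding content_enumerated W_def using approximates_sound[OF ws_approx] by fastforce

lemma eventually_enumerated:
  assumes "finite F" "F \<subseteq> W \<phi> e"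
  shows "\<forall>\<^sub>F t in sequentially. F \<subseteq> content_seq (enumerated e t)"
proof -
  have "\<forall>\<^sub>F t in sequentially. x \<in> content_seq (enumerated e t)" if x: "x \<in> F" for x
  proof -
    obtain y where "\<phi> e x = Some y" using assms(2) x by (auto simp: W_def)
    from approximates_eventually[OF ws_approx this] eventually_gt_at_top[of x]
    show ?thesis by eventually_elim (simp add: content_enumerated)
  qed
  then have "\<forall>\<^sub>F t in sequentially. \<forall>x\<in>F. x \<in> content_seq (enumerated e t)"
    by (intro eventually_ball_finite assms(1)) blast
  then show ?thesis by (simp only: subset_eq)
qed

lemma stage_0: "stage s 0 = s"
  and stage_Suc: "stage s (Suc t) = (case hs t (enc s) of None \<Rightarrow> stage s t
     | Some e \<Rightarrow> if covers s (enumerated e t) \<and> conflict t s (stage s t @ enumerated e t) = None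
                 then stage s t @ enumerated e t else stage s t)"
  unfolding stage_def by simp_all

lemma content_stage_mono:
  assumes "t \<le> t'" shows "content_seq (stage s t) \<subseteq> content_seq (stage s t')"
  using assms by (induction rule: dec_induct) (auto simp: stage_Suc split: option.split)

lemma content_seq_subset_hypothesis: "content_seq s \<subseteq> hypothesis s"
  using stage_0 unfolding hypothesis_def by (metis UN_upper UNIV_I)

text \<open>Approximated values are never retracted, so a disagreement once seen persists, and a
  larger \<open>F\<close> admits the same \<open>\<rho>\<close>.\<close>

lemma mind_change_mono:
  assumes "mind_change t s F \<rho>" "t \<le> t'" "content_seq F \<subseteq> content_seq F'"
  shows "mind_change t' s F' \<rho>"
proof -
  obtain e e' where e: "hs t (enc s) = Some e" "hs t (enc (s @ \<rho>)) = Some e'" "e \<noteq> e'"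
    using assms(1) unfolding mind_change_def by auto
  show ?thesis
    using assms approximates_mono[OF hs_approx e(1) assms(2)] approximates_mono[OF hs_approx e(2) assms(2)] e(3)
    unfolding mind_change_def covers_iff by auto
qed

text \<open>A mind change over \<open>\<sigma>\<close> known at time \<open>length \<sigma>\<close> blocks every later stage
  that would swallow the content of \<open>\<sigma>\<close>.\<close>
lemma update_content:
  assumes "update \<sigma> s \<noteq> s" shows "\<not> content_seq \<sigma> \<subseteq> hypothesis s"
proof
  assume sub: "content_seq \<sigma> \<subseteq> hypothesis s"
  let ?t = "length \<sigma>"
  obtain c where c: "conflict ?t s \<sigma> = Some c" "\<not> content_seq \<sigma> \<subseteq> content_seq (stage s ?t)"
    using assms unfolding update_def covers_iff by (auto split: option.splits if_splits)
  then have mc: "mind_change ?t s \<sigma> (decode_seq c)" "c < ?t"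
    unfolding conflict_def bounded_search_eq_Some_iff by auto
  have never: "\<not> content_seq \<sigma> \<subseteq> content_seq (stage s t)" if "?t \<le> t" for t
    using that
  proof (induction rule: dec_induct)
    case base
    then show ?case by (rule c(2))
  next
    case (step t)
    have "conflict t s F \<noteq> None" if "content_seq \<sigma> \<subseteq> content_seq F" for F
      unfolding conflict_def bounded_search_eq_None_iff
      using mind_change_mono[OF mc(1) step(1) that] mc(2) step(1) order.strict_trans2 by blast
    \<comment> \<open>A stage that changes has passed the conflict test with its new value, so it
      cannot contain all of \<open>\<sigma>\<close>.\<close>
    moreover have "stage s (Suc t) = stage s t \<or> conflict t s (stage s (Suc t)) = None"
      by (auto simp: stage_Suc split: option.split)
    ultimately show ?case using step.IH by metis
  qed
  have "\<forall>\<^sub>F t in sequentially. x \<in> content_seq (stage s t)" if "x \<in> content_seq \<sigma>" for x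
    using sub that content_stage_mono unfolding hypothesis_def eventually_sequentially by blast
  then have "\<forall>\<^sub>F t in sequentially. \<forall>x\<in>content_seq \<sigma>. x \<in> content_seq (stage s t)"
    by (intro eventually_ball_finite) auto
  \<comment> \<open>The content of \<open>\<sigma>\<close> is finite and the stages increase, so
    inclusion in their union means inclusion in one late stage.\<close>
  from eventually_happens'[OF sequentially_bot eventually_conj[OF this eventually_ge_at_top[of ?t]]]
  show False using never by blast
qed

text \<open>Translates the step-bounded tests into facts about \<open>h\<close> itself, as needed
  for the convergence of the states.\<close>

lemma update_cases:
  obtains "update \<sigma> s = s"
  | \<rho> where "update \<sigma> s = s @ \<rho> @ \<sigma>" "covers \<rho> \<sigma>" "h (enc s) \<noteq> None" "h (enc (s @ \<rho>)) \<noteq> None"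
      "h (enc (s @ \<rho>)) \<noteq> h (enc s)"
proof (cases "update \<sigma> s = s")
  case False
  then obtain c where c: "conflict (length \<sigma>) s \<sigma> = Some c" "update \<sigma> s = s @ decode_seq c @ \<sigma>"
    unfolding update_def by (auto split: option.splits if_splits)
  then have mc: "mind_change (length \<sigma>) s \<sigma> (decode_seq c)"
    unfolding conflict_def bounded_search_eq_Some_iff by auto
  then obtain e e' where e: "hs (length \<sigma>) (enc s) = Some e"
      "hs (length \<sigma>) (enc (s @ decode_seq c)) = Some e'" "e \<noteq> e'"
    unfolding mind_change_def by auto
  show thesis
    using that(2)[OF c(2)] mc e(3) approximates_sound[OF hs_approx e(1)] approximates_sound[OF hs_approx e(2)]
    unfolding mind_change_def by auto
qed (rule that(1))

lemma state_initseg_Suc: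
  "state (initseg T (Suc n)) = update (initseg T (Suc n)) (state (initseg T n))"
  unfolding initseg_Suc by (rule state_snoc)

lemma state_initseg_extends:
  assumes "n \<le> m" shows "\<exists>\<rho>. state (initseg T m) = state (initseg T n) @ \<rho>"
  using assms
proof (induction rule: dec_induct)
  case (step m)
  then show ?case unfolding state_initseg_Suc
    by (cases rule: update_cases[of "initseg T (Suc m)" "state (initseg T m)"]) auto
qed simp

lemma content_state: "content_seq (state (initseg T n)) \<subseteq> content_seq (initseg T n)"
proof (induction n)
  case (Suc n)
  have "content_seq (initseg T n) \<subseteq> content_seq (initseg T (Suc n))"
    by (rule content_seq_initseg_mono) simp
  with Suc show ?case unfolding state_initseg_Suc
    by (cases rule: update_cases[of "initseg T (Suc n)" "state (initseg T n)"])
      (auto simp: covers_iff)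
qed simp

text \<open>At a change of state between \<open>n\<close> and \<open>k\<close>, the segment
  \<open>?\<sigma>\<close> read there is absorbed by all later states, while
  \<open>update_content\<close> keeps part of it out of the old hypothesis. That part supplies the
  witness.\<close>

lemma state_witness:
  assumes "n \<le> k" "k \<le> m" "state (initseg T n) \<noteq> state (initseg T k)"
  shows "(content_seq (initseg T m) \<inter> hypothesis (state (initseg T m)))
    - hypothesis (state (initseg T n)) \<noteq> {}"
proof -
  have "\<exists>j. n \<le> j \<and> j < k \<and> state (initseg T j) = state (initseg T n)
      \<and> state (initseg T (Suc j)) \<noteq> state (initseg T j)"
    using assms(1,3)
  proof (induction rule: dec_induct)
    case (step i)
    then show ?case
      by (cases "state (initseg T n) = state (initseg T i)") (auto intro: less_SucI)
  qed simp
  then obtain j where j: "n \<le> j" "j < k" "state (initseg T j) = state (initseg T n)"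
    "state (initseg T (Suc j)) \<noteq> state (initseg T j)" by blast
  let ?\<sigma> = "initseg T (Suc j)"
  have "content_seq ?\<sigma> \<subseteq> content_seq (state ?\<sigma>)"
    using j(4) unfolding state_initseg_Suc
    by (cases rule: update_cases[of ?\<sigma> "state (initseg T j)"]) auto
  also have "\<dots> \<subseteq> content_seq (state (initseg T m))"
    using state_initseg_extends[of "Suc j" m T] j(2) assms(2) by auto
  also have "\<dots> \<subseteq> hypothesis (state (initseg T m))"
    by (rule content_seq_subset_hypothesis)
  finally have "content_seq ?\<sigma> \<subseteq> hypothesis (state (initseg T m))" .
  moreover have "content_seq ?\<sigma> \<subseteq> content_seq (initseg T m)"
    by (rule content_seq_initseg_mono) (use j(2) assms(2) in simp)
  moreover have "\<not> content_seq ?\<sigma> \<subseteq> hypothesis (state (initseg T n))"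
    using update_content[of ?\<sigma> "state (initseg T j)"] j(3,4) by (simp add: state_initseg_Suc)
  ultimately show ?thesis by blast
qed

text \<open>Nothing is added to \<open>s\<close> before its content has been found inside
  \<open>W \<phi> e\<close>.\<close>

lemma hypothesis_cases:
  assumes "h (enc s) = Some e"
  shows "hypothesis s = content_seq s \<or> hypothesis s \<subseteq> W \<phi> e"
proof -
  have "content_seq (stage s t) = content_seq s
      \<or> content_seq s \<subseteq> W \<phi> e \<and> content_seq (stage s t) \<subseteq> W \<phi> e" for t
  proof (induction t)
    case (Suc t)
    have "e' = e" if "hs t (enc s) = Some e'" for e'
      using approximates_sound[OF hs_approx that] assms by simp
    then show ?case
      using Suc content_enumerated_subset[of e t]
      by (auto simp: stage_Suc covers_iff split: option.split)
  qed (simp add: stage_0)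
  then have "hypothesis s \<subseteq> content_seq s \<or> hypothesis s \<subseteq> W \<phi> e"
    unfolding hypothesis_def by blast
  then show ?thesis using content_seq_subset_hypothesis by blast
qed

section \<open>Convergence on texts for a learned language\<close>

context
  fixes L :: "nat set"
  assumes learns: "TxtGEx_learns \<phi> CautTar h L"
begin

text \<open>Prepending \<open>s\<close> to a text for \<open>L\<close> gives a text for
  \<open>L\<close> with initial segment \<open>s\<close>, so guarantees about texts transfer to all
  finite sequences over \<open>L\<close>.\<close>

lemma learner_defined:
  assumes "content_seq s \<subseteq> L" "content T = L" shows "h (enc s) \<noteq> None" "\<not> L \<subset> W \<phi> (the (h (enc s)))"
proof -
  have "content (prepend s T) = L" using assms by (auto simp: content_prepend)
  then have "Gtotal h (prepend s T)" "CautTar \<phi> (G h (prepend s T)) (prepend s T)"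
      "content (prepend s T) = L"
    using learns unfolding TxtGEx_learns_def by blast+
  moreover have "Gseq h (prepend s T) (length s) = h (enc s)"
    using initseg_prepend[of s T 0] by (simp add: Gseq_def enc_eq_seq_code)
  ultimately show "h (enc s) \<noteq> None" "\<not> L \<subset> W \<phi> (the (h (enc s)))"
    unfolding Gtotal_def CautTar_def G_def by metis+
qed

lemma learner_converges:
  assumes "content T = L"
  obtains e n0 where "\<And>n. n \<ge> n0 \<Longrightarrow> h (enc (initseg T n)) = Some e" "W \<phi> e = L"
proof -
  have "Gtotal h T" "Ex \<phi> (G h T) T"
    using learns assms unfolding TxtGEx_learns_def by blast+
  then obtain n0 where n0: "\<forall>n\<ge>n0. G h T n = G h T n0" "W \<phi> (G h T n0) = L"
    unfolding Ex_def using assms by blast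
  have "h (enc (initseg T n)) = Some (G h T n)" for n
    using \<open>Gtotal h T\<close> unfolding Gtotal_def G_def Gseq_def by (simp add: enc_eq_seq_code)
  then show thesis using n0 that by metis
qed

text \<open>Otherwise the union of the states would be a text for \<open>L\<close> on which \<open>h\<close> diverges.\<close>
lemma state_converges:
  assumes T: "content T = L"
  obtains N where "\<And>n. n \<ge> N \<Longrightarrow> state (initseg T n) = state (initseg T N)"
proof (rule ccontr)
  assume not_thesis: "\<not> thesis"
  let ?st = "\<lambda>n. state (initseg T n)"
  have changes: "\<exists>m\<ge>n. ?st (Suc m) \<noteq> ?st m" for n
  proof (rule ccontr)
    assume *: "\<not> ?thesis"
    have "?st m = ?st n" if "n \<le> m" for m
      using that * by (induction rule: dec_induct) auto
    then show False using that not_thesis by blast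
  qed
  have longer: "\<exists>m. n \<le> length (?st m)" for n
  proof (induction n)
    case (Suc n)
    then obtain m where m: "n \<le> length (?st m)" by blast
    obtain k where k: "k \<ge> m" "?st (Suc k) \<noteq> ?st k" using changes by blast
    have "n \<le> length (?st k)" using m state_initseg_extends[OF k(1), of T] by auto
    moreover have "length (?st k) < length (?st (Suc k))"
      using state_initseg_extends[of k "Suc k" T] k(2) by auto
    ultimately show ?case by (intro exI[of _ "Suc k"]) simp
  qed simp
  \<comment> \<open>The union of the states: position \<open>i\<close> is read off a state that is
    long enough, and the choice is immaterial because states extend one another.\<close>
  define T' where "T' i = ?st (SOME m. Suc i \<le> length (?st m)) ! i" for i
  have T'_nth: "T' i = ?st m ! i" if "i < length (?st m)" for i m
  proof -
    let ?m = "SOME m. Suc i \<le> length (?st m)"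
    have "i < length (?st ?m)" using someI_ex[OF longer[of "Suc i"]] by simp
    then show ?thesis
      using that state_initseg_extends[of m ?m T] state_initseg_extends[of ?m m T]
      unfolding T'_def by (metis nat_le_linear nth_append)
  qed
  \<comment> \<open>Stated for prefixes of states because it is also applied to
    \<open>?st m @ \<rho>\<close>, an intermediate prefix of the next state.\<close>
  have T'_seg: "initseg T' (length s) = s" if "?st m = s @ r" for m s r
    by (rule nth_equalityI) (use T'_nth[of _ m] that in \<open>auto simp: initseg_def nth_append\<close>)
  have "content T' = L"
  proof (intro equalityI subsetI)
    fix x assume "x \<in> content T'"
    then obtain i where i: "T' i = Some x" by (auto simp: content_def)
    obtain m where "i < length (?st m)" using longer[of "Suc i"] by (metis Suc_le_eq)
    then have "x \<in> content_seq (?st m)"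
      using T'_nth i by (metis content_seq_def mem_Collect_eq nth_mem)
    then show "x \<in> L" using content_state[of T m] content_seq_initseg_subset[of T m] T by blast
  next
    fix x assume "x \<in> L"
    then obtain i where i: "T i = Some x" using T by (auto simp: content_def)
    \<comment> \<open>A change after \<open>x\<close> has been read appends a segment containing
      \<open>x\<close>.\<close>
    obtain m where m: "m \<ge> i" "?st (Suc m) \<noteq> ?st m" using changes by blast
    have "x \<in> content_seq (initseg T (Suc m))" using i m(1) by (auto simp: content_seq_initseg intro!: exI[of _ i])
    moreover have "content_seq (initseg T (Suc m)) \<subseteq> content_seq (?st (Suc m))"
      using m(2) unfolding state_initseg_Suc
      by (cases rule: update_cases[of "initseg T (Suc m)" "?st m"]) auto
    moreover have "content_seq (?st (Suc m)) \<subseteq> content T'"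
      using T'_seg[of "Suc m" "?st (Suc m)" "[]"] content_seq_initseg_subset[of T'] by (metis append_Nil2)
    ultimately show "x \<in> content T'" by blast
  qed
  then obtain e n0 where e: "\<And>n. n \<ge> n0 \<Longrightarrow> h (enc (initseg T' n)) = Some e"
    using learner_converges by metis
  \<comment> \<open>Beyond \<open>n0\<close>, both \<open>?st m\<close> and
    \<open>?st m @ \<rho>\<close> are initial segments of \<open>T'\<close>, where \<open>h\<close>
    already answers \<open>e\<close>; but the change requires \<open>h\<close> to disagree on
    them.\<close>
  obtain m0 where m0: "n0 \<le> length (?st m0)" using longer by blast
  obtain m where m: "m \<ge> m0" "?st (Suc m) \<noteq> ?st m" using changes by blast
  have n0: "n0 \<le> length (?st m)" using m0 state_initseg_extends[OF m(1), of T] by auto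
  from m(2) obtain \<rho> where \<rho>: "?st (Suc m) = ?st m @ \<rho> @ initseg T (Suc m)"
    "h (enc (?st m @ \<rho>)) \<noteq> h (enc (?st m))"
    unfolding state_initseg_Suc
    by (cases rule: update_cases[of "initseg T (Suc m)" "?st m"]) auto
  have "h (enc (?st m)) = Some e"
    using e[OF n0] T'_seg[of m "?st m" "[]"] by simp
  moreover have "h (enc (?st m @ \<rho>)) = Some e"
    using e[of "length (?st m @ \<rho>)"] T'_seg[of "Suc m" "?st m @ \<rho>"] n0 \<rho>(1) by simp
  ultimately show False using \<rho>(2) by simp
qed

lemma limit_hypothesis:
  assumes T: "content T = L" and lim: "\<And>n. n \<ge> N \<Longrightarrow> state (initseg T n) = s"
  shows "hypothesis s = L"
proof -
  have s_sub: "content_seq s \<subseteq> L"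
    using content_state[of T N] content_seq_initseg_subset[of T N] T lim by auto
  obtain e where e: "h (enc s) = Some e" using learner_defined(1)[OF s_sub T] by blast
  have caut: "\<not> L \<subset> W \<phi> e" using learner_defined(2)[OF s_sub T] e by simp
  show ?thesis
  proof (cases "L \<subseteq> hypothesis s")
    case True
    \<comment> \<open>Caution enters here: a hypothesis inside \<open>W \<phi> e\<close> puts
      \<open>L\<close> there too, and that inclusion cannot be proper.\<close>
    then show ?thesis using hypothesis_cases[OF e] s_sub caut by blast
  next
    case False
    \<comment> \<open>No stage contains \<open>x\<close>, so a segment containing \<open>x\<close>
      is never covered and cannot prevent an update.\<close>
    then obtain x where x: "x \<in> L" "x \<notin> hypothesis s" by blast
    have locked: "h (enc (s @ \<rho>)) = Some e" if \<rho>: "content_seq \<rho> \<subseteq> L" for \<rho>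
    proof (rule ccontr)
      assume "h (enc (s @ \<rho>)) \<noteq> Some e"
      moreover obtain e' where e': "h (enc (s @ \<rho>)) = Some e'"
        using learner_defined(1)[OF _ T, of "s @ \<rho>"] s_sub \<rho> by auto
      ultimately have "e' \<noteq> e" by simp
      have "\<forall>\<^sub>F n in sequentially. hs n (enc s) = Some e \<and> hs n (enc (s @ \<rho>)) = Some e'
          \<and> insert x (content_seq \<rho>) \<subseteq> content_seq (initseg T n) \<and> enc \<rho> < n \<and> Suc N \<le> n"
        by (intro eventually_conj approximates_eventually[OF hs_approx] e e' eventually_content_initseg
            eventually_gt_at_top eventually_ge_at_top) (use \<rho> x T in auto)
      \<comment> \<open>A length at which the mind change and \<open>x\<close> are both visible,
        exceeding the code of \<open>\<rho>\<close> for the bounded search and exceeding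
        \<open>N\<close> so that the preceding state is also \<open>s\<close>.\<close>
      then obtain n where n: "hs n (enc s) = Some e" "hs n (enc (s @ \<rho>)) = Some e'"
          "insert x (content_seq \<rho>) \<subseteq> content_seq (initseg T n)" "enc \<rho> < n" "Suc N \<le> n"
        using eventually_happens'[OF sequentially_bot] by blast
      have "mind_change n s (initseg T n) \<rho>"
        using n(1-3) \<open>e' \<noteq> e\<close> by (auto simp: mind_change_def covers_iff)
      then have "mind_change n s (initseg T n) (decode_seq (enc \<rho>))" by simp
      then have "conflict n s (initseg T n) \<noteq> None"
        unfolding conflict_def bounded_search_eq_None_iff using n(4) by blast
      moreover have "\<not> covers (initseg T n) (stage s n)"
        using n(3) x(2) unfolding covers_iff hypothesis_def by blast
      moreover have "initseg T n \<noteq> []" using n(5) by (metis length_0_conv length_initseg not_less_eq_eq zero_le)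
      ultimately have "update (initseg T n) s \<noteq> s"
        unfolding update_def by auto
      moreover obtain n' where "n = Suc n'" "N \<le> n'" using n(5) by (metis Suc_le_D Suc_le_mono)
      ultimately show False
        using state_initseg_Suc[of T n'] lim[of n] lim[of n'] by simp
    qed
    have "W \<phi> e = L"
    proof -
      \<comment> \<open>On a text for \<open>L\<close> that begins with \<open>s\<close>, the locked
        learner can only converge to \<open>e\<close>.\<close>
      have "content (prepend s T) = L" using s_sub T by (auto simp: content_prepend)
      then obtain e' n0 where e': "\<And>n. n \<ge> n0 \<Longrightarrow> h (enc (initseg (prepend s T) n)) = Some e'"
          "W \<phi> e' = L" using learner_converges by metis
      have "h (enc (s @ initseg T n0)) = Some e'"
        using e'(1)[of "length s + n0"] by (simp add: initseg_prepend)
      moreover have "h (enc (s @ initseg T n0)) = Some e"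
        by (rule locked) (use content_seq_initseg_subset T in blast)
      ultimately show ?thesis using e'(2) by simp
    qed
    then have hyp_sub: "hypothesis s \<subseteq> L" using hypothesis_cases[OF e] s_sub by blast
    have "\<forall>\<^sub>F t in sequentially. hs t (enc s) = Some e \<and>
        insert x (content_seq s) \<subseteq> content_seq (enumerated e t)"
      by (intro eventually_conj approximates_eventually[OF hs_approx] e eventually_enumerated)
        (use s_sub x \<open>W \<phi> e = L\<close> in auto)
    \<comment> \<open>At this stage \<open>x\<close> and all of \<open>s\<close> are enumerated. A
      blocking mind change would be over \<open>L\<close>, against \<open>locked\<close>, so
      \<open>x\<close> enters the hypothesis after all.\<close>
    then obtain t where t: "hs t (enc s) = Some e" "insert x (content_seq s) \<subseteq> content_seq (enumerated e t)"
      using eventually_happens'[OF sequentially_bot] by blast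
    let ?F = "stage s t @ enumerated e t"
    have F: "content_seq ?F \<subseteq> L"
      using hyp_sub content_enumerated_subset[of e t] \<open>W \<phi> e = L\<close> unfolding hypothesis_def by auto
    have "\<not> mind_change t s ?F \<rho>" for \<rho>
    proof
      assume mc: "mind_change t s ?F \<rho>"
      then obtain e' where e': "hs t (enc (s @ \<rho>)) = Some e'" "e' \<noteq> e"
        using t(1) unfolding mind_change_def by auto
      have "h (enc (s @ \<rho>)) = Some e"
        by (rule locked) (use mc F in \<open>auto simp: mind_change_def covers_iff\<close>)
      then show False using approximates_sound[OF hs_approx e'(1)] e'(2) by simp
    qed
    then have "stage s (Suc t) = ?F"
      using t unfolding stage_Suc conflict_def by (simp add: covers_iff bounded_search_eq_None_iff)
    then have "x \<in> hypothesis s"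
      using t(2) unfolding hypothesis_def by (auto intro!: exI[of _ "Suc t"])
    with x show ?thesis by blast
  qed
qed

end

section \<open>Computability of the construction\<close>

lemma computable_enumerated:
  assumes "computable e" "computable t" shows "computable (\<lambda>x. enumerated (e x) (t x))"
proof -
  have "computable (\<lambda>p. enumerated (fst p) (snd p))"
    unfolding enumerated_def
    by (intro computable_intros computable_app2[OF ws_computable])
  from computable_app2[OF this assms] show ?thesis .
qed

lemma computable_conflict:
  assumes "computable t" "computable s" "computable F"
  shows "computable (\<lambda>x. conflict (t x) (s x) (F x))"
proof -
  have "computable (\<lambda>p. conflict (fst p) (fst (snd p)) (snd (snd p)))"
    unfolding conflict_def mind_change_def
    by (intro computable_intros computable_app2[OF hs_computable])
  from computable_app3[OF this assms] show ?thesis .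
qed

lemma computable_stage:
  assumes "computable s" "computable t"
  shows "computable (\<lambda>x. stage (s x) (t x))"
proof -
  have "computable (\<lambda>p. stage (fst p) (snd p))"
    unfolding stage_def
    by (intro computable_intros computable_app2[OF hs_computable] computable_conflict computable_enumerated)
  from computable_app2[OF this assms] show ?thesis .
qed

lemma computable_update:
  assumes "computable \<sigma>" "computable s"
  shows "computable (\<lambda>x. update (\<sigma> x) (s x))"
proof -
  have "computable (\<lambda>p. update (fst p) (snd p))"
    unfolding update_def
    by (intro computable_intros computable_conflict computable_stage)
  from computable_app2[OF this assms] show ?thesis .
qed

lemma computable_state:
  assumes "computable \<sigma>" shows "computable (\<lambda>x. state (\<sigma> x))"
  unfolding state_def by (intro computable_intros computable_update assms)

text \<open>The hypotheses are uniformly enumerable from their states, so acceptability provides a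
  total computable \<open>r\<close> from state codes to indices. \<open>Wb\<close> holds on every
  text because \<open>state_witness\<close> assumes nothing about what \<open>h\<close>
  learns.\<close>

lemma wb_learner:
  assumes \<phi>: "acceptable \<phi>" and I: "R_monoid I"
  obtains g where "g \<in> I" "\<And>T. Gtotal g T" "\<And>T. Wb \<phi> (G g T) T"
    "\<And>L T. TxtGEx_learns \<phi> CautTar h L \<Longrightarrow> content T = L \<Longrightarrow> Ex \<phi> (G g T) T"
proof -
  \<comment> \<open>\<open>\<psi> c x\<close> is the first stage containing \<open>x\<close>, so its
    domain is the hypothesis of the state coded by \<open>c\<close>.\<close>
  define \<psi> where "\<psi> c x = (if \<exists>t. Some x \<in> set (stage (decode_seq c) t)
    then Some (LEAST t. Some x \<in> set (stage (decode_seq c) t)) else None)" for c x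
  have W_\<psi>: "W \<psi> (enc s) = hypothesis s" for s
    by (auto simp: W_def \<psi>_def hypothesis_def content_seq_def)
  have "pcomputable (\<lambda>p. if \<exists>t. Some (snd (prod_decode p)) \<in> set (stage (decode_seq (fst (prod_decode p))) t)
    then Some (LEAST t. Some (snd (prod_decode p)) \<in> set (stage (decode_seq (fst (prod_decode p))) t)) else None)"
    by (rule pcomputable_search) (intro computable_intros computable_stage)
  then have "computable_numbering \<psi>"
    unfolding computable_numbering_def \<psi>_def .
  then obtain r where r: "r \<in> Rfun" "\<And>c. \<psi> c = \<phi> (the (r c))"
    using \<phi> unfolding acceptable_def by blast
  define g where "g = pcomp r (\<lambda>n. Some (enc (state (decode_seq n))))"
  have "(\<lambda>n. Some (enc (state (decode_seq n)))) \<in> Rfun"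
    by (intro Rfun_computable computable_intros computable_state)
  then have "g \<in> I" using r(1) I unfolding g_def R_monoid_def by blast
  have "Gseq g T n = r (enc (state (initseg T n)))" for T n
    by (simp add: Gseq_def g_def pcomp_def flip: enc_eq_seq_code)
  moreover have "r c \<noteq> None" for c using r(1) unfolding Rfun_def by blast
  ultimately have total: "Gtotal g T" and G: "G g T n = the (r (enc (state (initseg T n))))" for T n
    by (simp_all add: Gtotal_def G_def)
  have W: "W \<phi> (G g T n) = hypothesis (state (initseg T n))" for T n
    unfolding G W_\<psi>[symmetric] W_def r(2) ..
  have "Wb \<phi> (G g T) T" for T
    unfolding Wb_def W
  proof (intro allI impI)
    fix n m assume "\<exists>k. n \<le> k \<and> k \<le> m \<and> G g T n \<noteq> G g T k"
    \<comment> \<open>An index depends only on the state, so different indices come from different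
      states.\<close>
    then obtain k where "n \<le> k" "k \<le> m" "state (initseg T n) \<noteq> state (initseg T k)"
      unfolding G by metis
    then show "content_seq (initseg T m) \<inter> hypothesis (state (initseg T m)) -
        hypothesis (state (initseg T n)) \<noteq> {}"
      by (rule state_witness)
  qed
  moreover have "Ex \<phi> (G g T) T" if L: "TxtGEx_learns \<phi> CautTar h L" "content T = L" for L T
  proof -
    obtain N where N: "\<And>n. n \<ge> N \<Longrightarrow> state (initseg T n) = state (initseg T N)"
      using state_converges[OF L] by metis
    then have "hypothesis (state (initseg T N)) = L" by (rule limit_hypothesis[OF L])
    then show ?thesis unfolding Ex_def W using N L(2) by (metis G)
  qed
  ultimately show thesis using that \<open>g \<in> I\<close> total by blast
qed

end

section \<open>The two directions of the equivalence\<close>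

text \<open>A hypothesis properly containing the content differs from the final one, whose set is
  the content; a witness would have to lie in the content but outside a superset of it.\<close>

lemma Wb_Ex_imp_CautTar:
  assumes wb: "Wb \<phi> p T" and ex: "Ex \<phi> p T" shows "CautTar \<phi> p T"
  unfolding CautTar_def
proof (intro allI notI)
  fix n assume n: "content T \<subset> W \<phi> (p n)"
  obtain n0 where n0: "\<And>k. k \<ge> n0 \<Longrightarrow> p k = p n0" "W \<phi> (p n0) = content T"
    using ex unfolding Ex_def by blast
  \<comment> \<open>The maximum is late enough for convergence and still at least \<open>n\<close>,
    as \<open>Wb\<close> requires.\<close>
  let ?m = "max n n0"
  have m: "p ?m = p n0" by (rule n0(1)) simp
  then have "p n \<noteq> p ?m" using n n0(2) by auto
  then have "content_seq (initseg T ?m) \<inter> W \<phi> (p ?m) - W \<phi> (p n) \<noteq> {}"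
    using wb[unfolded Wb_def, rule_format, of n ?m] by (meson max.cobounded1 order_refl)
  then show False using n n0(2) m by auto
qed

theorem theorem4:
  fixes \<phi> :: "nat \<Rightarrow> nat \<Rightarrow> nat option"
    and I :: "(nat \<Rightarrow> nat option) set"
    and S :: "nat set set"
    and \<L> :: "nat set set"
  assumes "acceptable \<phi>"
    and "R_monoid I"
    and "closed_under_subsets S"
  shows "(\<exists>h\<in>I. (\<forall>L\<in>\<L>. TxtGEx_learns \<phi> Wb h L) \<and>
                (\<forall>T. content T \<in> S \<longrightarrow> Gtotal h T \<and> Wb \<phi> (G h T) T))
     \<longleftrightarrow> (\<exists>h\<in>I. (\<forall>L\<in>\<L>. TxtGEx_learns \<phi> CautTar h L) \<and>
                (\<forall>T. content T \<in> S \<longrightarrow> Gtotal h T))"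
proof
  assume "\<exists>h\<in>I. (\<forall>L\<in>\<L>. TxtGEx_learns \<phi> Wb h L) \<and>
    (\<forall>T. content T \<in> S \<longrightarrow> Gtotal h T \<and> Wb \<phi> (G h T) T)"
  then show "\<exists>h\<in>I. (\<forall>L\<in>\<L>. TxtGEx_learns \<phi> CautTar h L) \<and> (\<forall>T. content T \<in> S \<longrightarrow> Gtotal h T)"
    unfolding TxtGEx_learns_def using Wb_Ex_imp_CautTar by metis
next
  assume "\<exists>h\<in>I. (\<forall>L\<in>\<L>. TxtGEx_learns \<phi> CautTar h L) \<and> (\<forall>T. content T \<in> S \<longrightarrow> Gtotal h T)"
  then obtain h where h: "h \<in> I" "\<And>L. L \<in> \<L> \<Longrightarrow> TxtGEx_learns \<phi> CautTar h L" by blast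
  have "pcomputable h" using h(1) assms(2) unfolding R_monoid_def by blast
  then obtain hs where hs: "computable (\<lambda>p. hs (fst p) (snd p))" "\<And>x. approximates (\<lambda>t. hs t x) (h x)"
    by (rule pcomputable_approximation) blast
  have "pcomputable (\<lambda>p. \<phi> (fst (prod_decode p)) (snd (prod_decode p)))"
    using assms(1) unfolding acceptable_def computable_numbering_def by blast
  then obtain ws where ws: "computable (\<lambda>p. ws (fst p) (snd p))"
    "\<And>p. approximates (\<lambda>t. ws t p) (\<phi> (fst (prod_decode p)) (snd (prod_decode p)))"
    by (rule pcomputable_approximation) blast
  interpret approximated_learner hs h ws \<phi>
  proof
    show "approximates (\<lambda>t. ws t (prod_encode (e, x))) (\<phi> e x)" for e x
      using ws(2)[of "prod_encode (e, x)"] by simp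
  qed (fact hs ws)+
  obtain g where g: "g \<in> I" "\<And>T. Gtotal g T" "\<And>T. Wb \<phi> (G g T) T"
    "\<And>L T. TxtGEx_learns \<phi> CautTar h L \<Longrightarrow> content T = L \<Longrightarrow> Ex \<phi> (G g T) T"
    using wb_learner[OF assms(1,2)] by metis
  then show "\<exists>h\<in>I. (\<forall>L\<in>\<L>. TxtGEx_learns \<phi> Wb h L) \<and>
    (\<forall>T. content T \<in> S \<longrightarrow> Gtotal h T \<and> Wb \<phi> (G h T) T)"
    using h(2) unfolding TxtGEx_learns_def by blast
qed

end
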